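(* Let $l_\infty\subset\mathbb P^2_{\mathbb C}$ be the line at infinity, and let $\mathcal B^+_{\mathbb R}(l_\infty)$ be the boundary of the real oriented blow-up of $\mathbb P^2_{\mathbb C}$ along $l_\infty$, parametrized by the two charts $(v_1,\theta_1)$ and $(v_2,\theta_2)$ described in the context. Let $S^3=\{(z_1,z_2)\in\mathbb C^2:|z_1|^2+|z_2|^2=1\}$. (a) The mapping $S^3\to\mathcal B^+_{\mathbb R}(l_\infty)$ given by $$(z_1,z_2)\mapsto\begin{cases} v_1=\dfrac{z_2}{z_1},\ \theta_1=-\arg z_1 & \text{if } z_1\ne0,\\[2mm] v_2=\dfrac{z_1}{z_2},\ \theta_2=-\arg z_2&\text{if } z_2\neq0,\end{cases}$$ is a diffeomorphism which carries the orientation of $S^3$ as the boundary of the complement of the 4-ball to the standard orientation of $\mathcal B^+_{\mathbb R}(l_\infty)$. (b) This diffeomorphism transforms the circle action $\Theta*(z_1,z_2)=(e^{-i\Theta}z_1,e^{-i\Theta}z_2)$ into the canonical circle action $\Theta*(v_j,\theta_j)=(v_j,\theta_j+\Theta)$.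
   Context: With $(x,y)$ the affine coordinates of $\mathbb C^2=\mathbb P^2_{\mathbb C}-l_\infty$, a neighborhood of $l_\infty$ is covered by two charts with coordinates $(u_1,v_1)$, $u_1=1/x,\ v_1=y/x$, and $(u_2,v_2)$, $u_2=1/y,\ v_2=x/y$; in each, $l_\infty=\{u_j=0\}$. The real oriented blow-up $\mathcal B^+_{\mathbb R}(\mathbb P^2,l_\infty)$ is, over each chart, the closure of $\{(u_j,v_j,\theta_j): u_j\neq0,\ u_j/|u_j|=e^{i\theta_j}\}$, $\theta_j\in\mathbb R/2\pi\mathbb Z$, in $\mathbb C\times\mathbb C\times\mathbb R/2\pi\mathbb Z$ (and it equals $\mathbb C^2$ away from $l_\infty$); it is a 4-manifold with boundary $\mathcal B^+_{\mathbb R}(l_\infty)$, given by $u_j=0$. So $\mathcal B^+_{\mathbb R}(l_\infty)$ is covered by the two charts $(v_j,\theta_j)\in\mathbb C\times\mathbb R/2\pi\mathbb Z$, $j=1,2$, with $v_2=1/v_1$, $\theta_2=\theta_1-\arg v_1$ on the overlap. Standard orientation: $\mathcal B^+_{\mathbb R}(l_\infty)$ is given the opposite of its orientation as boundary of the (complex-oriented) manifold $\mathcal B^+_{\mathbb R}(\mathbb P^2,l_\infty)$; i.e. it is oriented as the boundary of a tubular neighborhood of $l_\infty$. *)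

theory Defs
  imports "HOL-Analysis.Analysis"
begin

section \<open>Smooth maps\<close>

primrec Ck_on :: "nat \<Rightarrow> 'a::real_normed_vector set \<Rightarrow> ('a \<Rightarrow> 'b::real_normed_vector) \<Rightarrow> bool" where
  "Ck_on 0 U f \<longleftrightarrow> continuous_on U f"
| "Ck_on (Suc k) U f \<longleftrightarrow>
     (\<forall>x\<in>U. f differentiable (at x)) \<and>
     (\<forall>h. Ck_on k U (\<lambda>x. frechet_derivative f (at x) h))"

text \<open>On an arbitrary subset of a normed space, smooth means: locally the restriction of a
  \<open>C\<^sup>\<infinity>\<close> map defined on an open set.\<close>

definition smooth_on :: "'a::real_normed_vector set \<Rightarrow> ('a \<Rightarrow> 'b::real_normed_vector) \<Rightarrow> bool" where
  "smooth_on A f \<longleftrightarrow>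
     (\<forall>a\<in>A. \<exists>U F. open U \<and> a \<in> U \<and> (\<forall>k. Ck_on k U F) \<and> (\<forall>x\<in>A \<inter> U. F x = f x))"

section \<open>Four-manifolds with boundary and their boundaries\<close>

text \<open>A smooth structure is given by a set of local parametrizations \<open>(D, p)\<close>, where \<open>p\<close> is injective
  on \<open>D\<close>. Four-manifolds with boundary are modelled on the half space \<open>x\<^sub>1 \<le> 0\<close>, so that the
  first basis vector points outwards along the boundary.\<close>

definition half_space4 :: "(real^4) set" where
  "half_space4 = {x. x $ 1 \<le> 0}"

text \<open>The diffeomorphisms from relatively open subsets of the half space onto relatively open
  subsets of \<open>X\<close>.\<close>

definition local_params ::
    "'e::euclidean_space set \<Rightarrow> ((real^4) set \<times> (real^4 \<Rightarrow> 'e)) set" where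
  "local_params X =
     {(D, g). openin (top_of_set half_space4) D \<and> openin (top_of_set X) (g ` D) \<and> inj_on g D \<and>
              smooth_on D g \<and> smooth_on (g ` D) (the_inv_into D g)}"

definition boundary_atlas ::
    "((real^4) set \<times> (real^4 \<Rightarrow> 'm)) set \<Rightarrow> ((real^3) set \<times> (real^3 \<Rightarrow> 'm)) set" where
  "boundary_atlas A =
     (\<lambda>(D, p). ({y. vector [0, y $ 1, y $ 2, y $ 3] \<in> D},
                \<lambda>y. p (vector [0, y $ 1, y $ 2, y $ 3]))) ` A"

definition real_coords :: "complex \<times> complex \<Rightarrow> real^4" where
  "real_coords z = vector [Re (fst z), Im (fst z), Re (snd z), Im (snd z)]"

text \<open>The parametrizations that are positive for the complex orientation, where \<open>c\<close> are complex
  coordinates on the interior. Since the half space is \<open>x\<^sub>1 \<le> 0\<close>, \<^const>\<open>boundary_atlas\<close> of these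
  is an oriented atlas for the boundary orientation (outward normal first).\<close>

definition complex_positive ::
    "('m \<Rightarrow> complex \<times> complex) \<Rightarrow> ((real^4) set \<times> (real^4 \<Rightarrow> 'm)) set \<Rightarrow>
     ((real^4) set \<times> (real^4 \<Rightarrow> 'm)) set" where
  "complex_positive c A =
     {(D, p) \<in> A. \<forall>x\<in>D. x $ 1 < 0 \<longrightarrow>
        0 < det (matrix (frechet_derivative (\<lambda>x. real_coords (c (p x))) (at x)))}"

definition opposite_atlas ::
    "((real^3) set \<times> (real^3 \<Rightarrow> 'm)) set \<Rightarrow> ((real^3) set \<times> (real^3 \<Rightarrow> 'm)) set" where
  "opposite_atlas A =
     (\<lambda>(E, q). ({y. vector [- y $ 1, y $ 2, y $ 3] \<in> E},
                \<lambda>y. q (vector [- y $ 1, y $ 2, y $ 3]))) ` A"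

definition smooth_map ::
    "((real^3) set \<times> (real^3 \<Rightarrow> 'm)) set \<Rightarrow> ((real^3) set \<times> (real^3 \<Rightarrow> 'n)) set \<Rightarrow>
     ('m \<Rightarrow> 'n) \<Rightarrow> bool" where
  "smooth_map A B f \<longleftrightarrow>
     (\<forall>(D, p)\<in>A. \<forall>(E, q)\<in>B.
        open {x \<in> D. f (p x) \<in> q ` E} \<and>
        smooth_on {x \<in> D. f (p x) \<in> q ` E} (\<lambda>x. the_inv_into E q (f (p x))))"

definition diffeomorphism ::
    "'m set \<Rightarrow> ((real^3) set \<times> (real^3 \<Rightarrow> 'm)) set \<Rightarrow>
     'n set \<Rightarrow> ((real^3) set \<times> (real^3 \<Rightarrow> 'n)) set \<Rightarrow> ('m \<Rightarrow> 'n) \<Rightarrow> bool" where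
  "diffeomorphism M A N B f \<longleftrightarrow>
     bij_betw f M N \<and> smooth_map A B f \<and> smooth_map B A (inv_into M f)"

definition orientation_preserving ::
    "((real^3) set \<times> (real^3 \<Rightarrow> 'm)) set \<Rightarrow> ((real^3) set \<times> (real^3 \<Rightarrow> 'n)) set \<Rightarrow>
     ('m \<Rightarrow> 'n) \<Rightarrow> bool" where
  "orientation_preserving A B f \<longleftrightarrow>
     (\<forall>(D, p)\<in>A. \<forall>(E, q)\<in>B. \<forall>x\<in>D. f (p x) \<in> q ` E \<longrightarrow>
        0 < det (matrix (frechet_derivative (\<lambda>x. the_inv_into E q (f (p x))) (at x))))"

section \<open>The circle \<open>\<real> / 2\<pi>\<int>\<close>\<close>

quotient_type angle = real / "\<lambda>s t. \<exists>k::int. s = t + 2 * pi * of_int k"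
  morphisms rep_angle angle_of
proof (rule equivpI)
  show "reflp (\<lambda>s t. \<exists>k::int. s = t + 2 * pi * of_int k)"
    by (rule reflpI) (rule exI[of _ 0], simp)
  show "symp (\<lambda>s t. \<exists>k::int. s = t + 2 * pi * of_int k)"
  proof (rule sympI)
    fix s t :: real
    assume "\<exists>k::int. s = t + 2 * pi * of_int k"
    then obtain k :: int where "s = t + 2 * pi * of_int k" ..
    then have "t = s + 2 * pi * of_int (- k)" by simp
    then show "\<exists>k::int. t = s + 2 * pi * of_int k" ..
  qed
  show "transp (\<lambda>s t. \<exists>k::int. s = t + 2 * pi * of_int k)"
  proof (rule transpI)
    fix r s t :: real
    assume "\<exists>k::int. r = s + 2 * pi * of_int k" "\<exists>k::int. s = t + 2 * pi * of_int k"
    then obtain k l :: int where "r = s + 2 * pi * of_int k" "s = t + 2 * pi * of_int l" by blast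
    then have "r = t + 2 * pi * of_int (l + k)" by (simp add: algebra_simps)
    then show "\<exists>k::int. r = t + 2 * pi * of_int k" ..
  qed
qed

instantiation angle :: ab_group_add
begin

lift_definition zero_angle :: angle is 0 .

lift_definition plus_angle :: "angle \<Rightarrow> angle \<Rightarrow> angle" is "(+)"
proof -
  fix a b c d :: real
  assume "\<exists>k::int. a = b + 2 * pi * of_int k" "\<exists>k::int. c = d + 2 * pi * of_int k"
  then obtain k l :: int where "a = b + 2 * pi * of_int k" "c = d + 2 * pi * of_int l" by blast
  then have "a + c = b + d + 2 * pi * of_int (k + l)" by (simp add: algebra_simps)
  then show "\<exists>k::int. a + c = b + d + 2 * pi * of_int k" ..
qed

lift_definition uminus_angle :: "angle \<Rightarrow> angle" is uminus
proof -
  fix a b :: real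
  assume "\<exists>k::int. a = b + 2 * pi * of_int k"
  then obtain k :: int where "a = b + 2 * pi * of_int k" ..
  then have "- a = - b + 2 * pi * of_int (- k)" by simp
  then show "\<exists>k::int. - a = - b + 2 * pi * of_int k" ..
qed

definition minus_angle :: "angle \<Rightarrow> angle \<Rightarrow> angle" where
  "minus_angle a b = a + - b"

instance
proof
  fix a b c :: angle
  show "a + b + c = a + (b + c)" by transfer (rule exI[of _ 0], simp)
  show "a + b = b + a" by transfer (rule exI[of _ 0], simp)
  show "0 + a = a" by transfer (rule exI[of _ 0], simp)
  show "- a + a = 0" by transfer (rule exI[of _ 0], simp)
  show "a - b = a + - b" by (rule minus_angle_def)
qed

end

instantiation angle :: topological_space
begin

definition open_angle :: "angle set \<Rightarrow> bool" where
  "open_angle U \<longleftrightarrow> open (angle_of -` U)"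

instance
  by standard (auto simp: open_angle_def vimage_Union)

end

lift_definition cis_angle :: "angle \<Rightarrow> complex" is cis
proof -
  fix s t :: real
  assume "\<exists>k::int. s = t + 2 * pi * of_int k"
  then obtain k :: int where "s = t + 2 * pi * of_int k" ..
  then show "cis s = cis t" by (simp add: cis_multiple_2pi flip: cis_mult)
qed

lifting_forget angle.lifting

definition arg :: "complex \<Rightarrow> angle" where
  "arg z = angle_of (Arg z)"

section \<open>The real oriented blow-up of the projective plane along the line at infinity\<close>

text \<open>The two copies of \<open>(v\<^sub>j, \<theta>\<^sub>j) \<in> \<complex> \<times> \<real>/2\<pi>\<int>\<close> glued along
  \<open>v\<^sub>2 = 1/v\<^sub>1\<close>, \<open>\<theta>\<^sub>2 = \<theta>\<^sub>1 - arg v\<^sub>1\<close>.\<close>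

fun glue :: "(complex \<times> angle) + (complex \<times> angle) \<Rightarrow> (complex \<times> angle) + (complex \<times> angle) \<Rightarrow> bool" where
  "glue (Inl a) (Inl b) \<longleftrightarrow> a = b"
| "glue (Inr a) (Inr b) \<longleftrightarrow> a = b"
| "glue (Inl (v1, \<theta>1)) (Inr (v2, \<theta>2)) \<longleftrightarrow> v1 \<noteq> 0 \<and> v2 = 1 / v1 \<and> \<theta>2 = \<theta>1 - arg v1"
| "glue (Inr (v2, \<theta>2)) (Inl (v1, \<theta>1)) \<longleftrightarrow> v1 \<noteq> 0 \<and> v2 = 1 / v1 \<and> \<theta>2 = \<theta>1 - arg v1"

quotient_type linf_boundary = "(complex \<times> angle) + (complex \<times> angle)" / glue
proof (rule equivpI)
  show "reflp glue"
    by (rule reflpI) (metis glue.simps(1,2) sum.exhaust)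
  show "symp glue"
  proof (rule sympI)
    fix a b
    assume "glue a b"
    then show "glue b a" by (cases "(a, b)" rule: glue.cases) auto
  qed
  show "transp glue"
  proof (rule transpI)
    fix a b c
    assume "glue a b" "glue b c"
    then show "glue a c"
      by (cases "(a, b)" rule: glue.cases; cases "(b, c)" rule: glue.cases) auto
  qed
qed

lift_definition linf_chart1 :: "complex \<times> angle \<Rightarrow> linf_boundary" is Inl .

lift_definition linf_chart2 :: "complex \<times> angle \<Rightarrow> linf_boundary" is Inr .

datatype blowup = Affine (affine_coords: "complex \<times> complex") | At_infinity linf_boundary

text \<open>The part of the blow-up over a chart \<open>(u, v)\<close> of the projective plane.\<close>

definition blowup_local :: "(complex \<times> complex \<times> angle) set" where
  "blowup_local = closure {(u, v, \<theta>). u \<noteq> 0 \<and> u / of_real (norm u) = cis_angle \<theta>}"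

text \<open>Here \<open>(x, y) = (1/u\<^sub>1, v\<^sub>1/u\<^sub>1) = (v\<^sub>2/u\<^sub>2, 1/u\<^sub>2)\<close>.\<close>

definition blowup_chart1 :: "complex \<times> complex \<times> angle \<Rightarrow> blowup" where
  "blowup_chart1 = (\<lambda>(u, v, \<theta>).
     if u = 0 then At_infinity (linf_chart1 (v, \<theta>)) else Affine (1 / u, v / u))"

definition blowup_chart2 :: "complex \<times> complex \<times> angle \<Rightarrow> blowup" where
  "blowup_chart2 = (\<lambda>(u, v, \<theta>).
     if u = 0 then At_infinity (linf_chart2 (v, \<theta>)) else Affine (v / u, 1 / u))"

text \<open>The smooth structure that \<^const>\<open>blowup_local\<close> has as a submanifold with boundary of
  \<open>\<complex> \<times> \<complex> \<times> \<real>/2\<pi>\<int>\<close>, described on the covering \<open>\<complex> \<times> \<complex> \<times> \<real>\<close>, together with that of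
  the affine plane.\<close>

definition angle_cover :: "complex \<times> complex \<times> real \<Rightarrow> complex \<times> complex \<times> angle" where
  "angle_cover = (\<lambda>(u, v, t). (u, v, angle_of t))"

definition blowup_atlas :: "((real^4) set \<times> (real^4 \<Rightarrow> blowup)) set" where
  "blowup_atlas =
     {(D, Affine \<circ> g) | D g. (D, g) \<in> local_params UNIV} \<union>
     {(D, \<kappa> \<circ> angle_cover \<circ> g) | D g \<kappa>.
        \<kappa> \<in> {blowup_chart1, blowup_chart2} \<and>
        (D, g) \<in> local_params (angle_cover -` blowup_local) \<and>
        inj_on (angle_cover \<circ> g) D}"

text \<open>The boundary with the opposite of its boundary orientation.\<close>

definition linf_standard_atlas :: "((real^3) set \<times> (real^3 \<Rightarrow> blowup)) set" where
  "linf_standard_atlas =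
     opposite_atlas (boundary_atlas (complex_positive affine_coords blowup_atlas))"

lift_definition linf_action :: "angle \<Rightarrow> linf_boundary \<Rightarrow> linf_boundary" is
  "\<lambda>\<Theta>. map_sum (\<lambda>(v, \<theta>). (v, \<theta> + \<Theta>)) (\<lambda>(v, \<theta>). (v, \<theta> + \<Theta>))"
proof -
  fix \<Theta> :: angle and a b
  assume "glue a b"
  then show "glue (map_sum (\<lambda>(v, \<theta>). (v, \<theta> + \<Theta>)) (\<lambda>(v, \<theta>). (v, \<theta> + \<Theta>)) a)
                  (map_sum (\<lambda>(v, \<theta>). (v, \<theta> + \<Theta>)) (\<lambda>(v, \<theta>). (v, \<theta> + \<Theta>)) b)"
    by (cases "(a, b)" rule: glue.cases) (auto simp: algebra_simps)
qed

section \<open>The three-sphere\<close>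

definition S3 :: "(complex \<times> complex) set" where
  "S3 = {(z1, z2). (norm z1)\<^sup>2 + (norm z2)\<^sup>2 = 1}"

text \<open>The complement of the open unit ball; its boundary is \<^const>\<open>S3\<close>.\<close>

definition ball_complement_atlas :: "((real^4) set \<times> (real^4 \<Rightarrow> complex \<times> complex)) set" where
  "ball_complement_atlas = local_params {(z1, z2). 1 \<le> (norm z1)\<^sup>2 + (norm z2)\<^sup>2}"

definition S3_action :: "angle \<Rightarrow> complex \<times> complex \<Rightarrow> complex \<times> complex" where
  "S3_action \<Theta> = (\<lambda>(z1, z2). (cis_angle (- \<Theta>) * z1, cis_angle (- \<Theta>) * z2))"

definition S3_to_linf :: "complex \<times> complex \<Rightarrow> linf_boundary" where
  "S3_to_linf = (\<lambda>(z1, z2).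
     if z1 \<noteq> 0 then linf_chart1 (z2 / z1, - arg z1) else linf_chart2 (z1 / z2, - arg z2))"

end

theory Submission
  imports Defs
begin

text \<open>
  The diffeomorphism is the boundary value of one between 4-manifolds with boundary. The radial
  map \<open>z \<mapsto> z / (\<bar>z\<bar>\<^sup>2 - \<bar>z\<bar>)\<close> sends the complement of the closed ball to \<open>\<complex>\<^sup>2 - {0}\<close>; as \<open>z\<close> tends to
  \<open>S\<^sup>3\<close> its image goes to infinity along a fixed real ray, so the map extends to \<open>to_blowup\<close>, which is
  \<open>S3_to_linf\<close> on \<open>S\<^sup>3\<close>. Over the covering \<open>\<complex> \<times> \<complex> \<times> \<real>\<close> its inverse is the globally smooth map \<open>from_cover\<close>,
  which has smooth local inverses. Composing with it turns every chart of the blow-up that meets the boundary into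
  a chart of the ball complement, and both smoothness claims become the compatibility of charts of
  one manifold with boundary. The radial map reverses the orientation, because it inverts lengths along
  rays; this is compensated by the standard orientation being opposite to the boundary orientation.
\<close>

section \<open>Calculus of smooth maps\<close>

text \<open>The factor in \<open>radial_inversion\<close> is chosen so that norm R goes to 1 / (R -
  1). In the chart u = 1/x, v = y/x this gives |u| = (R - 1) / s with s = (1 + |v|^2)^(-1/2). So R =
  1 + s |u| is affine in |u|, and with t the argument of u the first coordinate is z1 = s R e^(-it)
  = s e^(-it) + s^2 conj(u). The last form no longer contains |u|, which is not smooth at u = 0;
  this is why \<open>from_cover\<close> is smooth across the boundary. A second obstacle lies in the
  charts: \<open>local_params\<close> does not ask that the face \<open>x $ 1 = 0\<close> be carried
  to the boundary of the target. This must be derived before charts can be restricted to the face,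
  and it is done by a first-order argument at extrema. Finally, positivity of charts is prescribed
  only at interior points, so the sign of a Jacobian determinant reaches the boundary by continuity,
  combined with invertibility there.\<close>

lemma Ck_on_cong:
  assumes "open U" "\<And>x. x \<in> U \<Longrightarrow> f x = g x" "Ck_on k U f"
  shows "Ck_on k U g"
  using assms(2,3)
proof (induction k arbitrary: f g)
  case 0
  then show ?case using continuous_on_cong[of U U f g] by simp
next
  case (Suc k)
  have d: "(g has_derivative frechet_derivative f (at x)) (at x)" if "x \<in> U" for x
  proof (rule has_derivative_transform_within_open[OF _ assms(1) that])
    show "(f has_derivative frechet_derivative f (at x)) (at x)"
      using Suc.prems that by (simp add: frechet_derivative_works)
  qed (use Suc.prems in auto)
  then have eq: "frechet_derivative f (at x) = frechet_derivative g (at x)" if "x \<in> U" for x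
    using frechet_derivative_at that by blast
  have "Ck_on k U (\<lambda>x. frechet_derivative g (at x) h)" for h
    by (rule Suc.IH[of "\<lambda>x. frechet_derivative f (at x) h"]) (use Suc.prems eq in auto)
  with d show ?case by (auto simp: differentiable_def)
qed

text \<open>\<open>frechet_derivative\<close> is a chosen derivative; on an open set uniqueness
  allows an explicit formula \<open>f'\<close> to stand for it. The inductions on the order of
  differentiability below go through this rule.\<close>

lemma Ck_on_SucI:
  assumes "open U" "\<And>x. x \<in> U \<Longrightarrow> (f has_derivative f' x) (at x)"
    and "\<And>h. Ck_on k U (\<lambda>x. f' x h)"
  shows "Ck_on (Suc k) U f"
proof -
  have "Ck_on k U (\<lambda>x. frechet_derivative f (at x) h)" for h
  proof (rule Ck_on_cong[OF assms(1) _ assms(3)])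
    fix x assume "x \<in> U"
    then show "f' x h = frechet_derivative f (at x) h"
      using assms(2) frechet_derivative_at by metis
  qed
  with assms(2) show ?thesis by (auto simp: differentiable_def)
qed

lemma Ck_on_SucD:
  "Ck_on (Suc k) U f \<Longrightarrow> x \<in> U \<Longrightarrow> (f has_derivative frechet_derivative f (at x)) (at x)"
  by (simp add: frechet_derivative_works)

lemma Ck_on_Suc_imp: "Ck_on (Suc k) U f \<Longrightarrow> Ck_on k U f"
proof (induction k arbitrary: f)
  case 0
  then show ?case
    by (auto intro!: continuous_at_imp_continuous_on differentiable_imp_continuous_within)
next
  case (Suc k)
  have "Ck_on k U (\<lambda>x. frechet_derivative f (at x) h)" for h
  proof (rule Suc.IH)
    show "Ck_on (Suc k) U (\<lambda>x. frechet_derivative f (at x) h)"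
      using Suc.prems by (subst (asm) Ck_on.simps(2)) blast
  qed
  with Suc.prems show ?case by simp
qed

lemma Ck_on_imp_continuous_on: "Ck_on k U f \<Longrightarrow> continuous_on U f"
proof (induction k)
  case (Suc k)
  then show ?case using Ck_on_Suc_imp by blast
qed simp

lemma Ck_on_subset: "Ck_on k U f \<Longrightarrow> V \<subseteq> U \<Longrightarrow> Ck_on k V f"
  by (induction k arbitrary: f) (auto intro: continuous_on_subset)

lemma Ck_on_const: "Ck_on k U (\<lambda>x. c)"
  by (induction k arbitrary: c) auto

lemma Ck_on_linear_compose:
  assumes "open U" "bounded_linear L" "Ck_on k U f"
  shows "Ck_on k U (\<lambda>x. L (f x))"
  using assms(3)
proof (induction k arbitrary: f)
  case 0
  then show ?case
    using bounded_linear.continuous_on[OF assms(2)] by simp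
next
  case (Suc k)
  show ?case
  proof (rule Ck_on_SucI[OF assms(1)])
    show "((\<lambda>x. L (f x)) has_derivative (\<lambda>h. L (frechet_derivative f (at x) h))) (at x)"
      if "x \<in> U" for x
      by (rule bounded_linear.has_derivative[OF assms(2) Ck_on_SucD[OF Suc.prems that]])
    show "Ck_on k U (\<lambda>x. L (frechet_derivative f (at x) h))" for h
      using Suc by simp
  qed
qed

lemma Ck_on_add:
  assumes "open U" "Ck_on k U f" "Ck_on k U g"
  shows "Ck_on k U (\<lambda>x. f x + g x)"
  using assms(2,3)
proof (induction k arbitrary: f g)
  case 0
  then show ?case by (simp add: continuous_on_add)
next
  case (Suc k)
  show ?case
  proof (rule Ck_on_SucI[OF assms(1)])
    show "((\<lambda>x. f x + g x) has_derivative
        (\<lambda>h. frechet_derivative f (at x) h + frechet_derivative g (at x) h)) (at x)"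
      if "x \<in> U" for x
      by (rule has_derivative_add[OF Ck_on_SucD[OF Suc.prems(1) that] Ck_on_SucD[OF Suc.prems(2) that]])
    show "Ck_on k U (\<lambda>x. frechet_derivative f (at x) h + frechet_derivative g (at x) h)" for h
      using Suc by simp
  qed
qed

lemma Ck_on_bilinear:
  assumes "open U" "bounded_bilinear B" "Ck_on k U f" "Ck_on k U g"
  shows "Ck_on k U (\<lambda>x. B (f x) (g x))"
  using assms(3,4)
proof (induction k arbitrary: f g)
  case 0
  then show ?case by (simp add: bounded_bilinear.continuous_on[OF assms(2)])
next
  case (Suc k)
  note fg = Suc.prems[THEN Ck_on_Suc_imp]
  show ?case
  proof (rule Ck_on_SucI[OF assms(1)])
    show "((\<lambda>x. B (f x) (g x)) has_derivative
        (\<lambda>h. B (f x) (frechet_derivative g (at x) h) + B (frechet_derivative f (at x) h) (g x))) (at x)"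
      if "x \<in> U" for x
      by (rule bounded_bilinear.FDERIV[OF assms(2) Ck_on_SucD[OF Suc.prems(1) that] Ck_on_SucD[OF Suc.prems(2) that]])
    show "Ck_on k U (\<lambda>x. B (f x) (frechet_derivative g (at x) h) + B (frechet_derivative f (at x) h) (g x))" for h
      using Suc fg by (intro Ck_on_add assms(1)) (auto intro!: Suc.IH)
  qed
qed

lemmas Ck_on_mult = Ck_on_bilinear[OF _ bounded_bilinear_mult]
lemmas Ck_on_scaleR = Ck_on_bilinear[OF _ bounded_bilinear_scaleR]
lemmas Ck_on_inner = Ck_on_bilinear[OF _ bounded_bilinear_inner]

lemma Ck_on_linear:
  assumes "bounded_linear L"
  shows "Ck_on k U L"
proof (cases k)
  case 0
  then show ?thesis using linear_continuous_on[OF assms] by simp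
next
  case (Suc j)
  have "Ck_on (Suc j) UNIV L"
    by (rule Ck_on_SucI[where f' = "\<lambda>x. L"])
      (use bounded_linear_imp_has_derivative[OF assms] Ck_on_const in auto)
  then show ?thesis using Suc Ck_on_subset by blast
qed

lemma Ck_on_minus: "open U \<Longrightarrow> Ck_on k U f \<Longrightarrow> Ck_on k U (\<lambda>x. - f x)"
  by (rule Ck_on_linear_compose[OF _ bounded_linear_minus[OF bounded_linear_ident]])

lemma Ck_on_diff: "open U \<Longrightarrow> Ck_on k U f \<Longrightarrow> Ck_on k U g \<Longrightarrow> Ck_on k U (\<lambda>x. f x - g x)"
  using Ck_on_add[OF _ _ Ck_on_minus] by fastforce

lemma Ck_on_sum:
  assumes "open U" "\<And>i. i \<in> I \<Longrightarrow> Ck_on k U (f i)"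
  shows "Ck_on k U (\<lambda>x. \<Sum>i\<in>I. f i x)"
  using assms(2)
  by (induction I rule: infinite_finite_induct) (auto intro: Ck_on_const Ck_on_add assms(1))

text \<open>In the chain rule the derivative of \<open>g\<close> is applied to a direction that
  itself varies with \<open>x\<close>, while \<open>Ck_on\<close> only speaks of fixed directions.
  Expanding that direction in a basis of the middle space turns the expression into a finite sum of
  products covered by the induction hypothesis; hence the middle type is Euclidean.\<close>

lemma Ck_on_compose:
  fixes f :: "'a::real_normed_vector \<Rightarrow> 'b::euclidean_space"
    and g :: "'b \<Rightarrow> 'c::real_normed_vector"
  assumes "open U" "Ck_on k U f" "Ck_on k V g" "f ` U \<subseteq> V"
  shows "Ck_on k U (\<lambda>x. g (f x))"
  using assms(2,3)
proof (induction k arbitrary: g)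
  case 0
  then show ?case using assms(4) by (auto intro: continuous_on_compose2)
next
  case (Suc k)
  show ?case
  proof (rule Ck_on_SucI[OF assms(1)])
    fix x assume x: "x \<in> U"
    then have fx: "f x \<in> V" using assms(4) by auto
    let ?D = "frechet_derivative g (at (f x))"
    have g: "(g has_derivative ?D) (at (f x))" by (rule Ck_on_SucD[OF Suc.prems(2) fx])
    interpret D: bounded_linear ?D using g by (rule has_derivative_bounded_linear)
    have D: "?D w = (\<Sum>b\<in>Basis. (w \<bullet> b) *\<^sub>R ?D b)" for w
      using arg_cong[OF euclidean_representation[of w], of ?D] by (simp only: D.sum D.scaleR)
    have "(\<lambda>h. ?D (frechet_derivative f (at x) h)) =
      (\<lambda>h. \<Sum>b\<in>Basis. (frechet_derivative f (at x) h \<bullet> b) *\<^sub>R ?D b)"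
      by (rule ext) (rule D)
    then show "((\<lambda>x. g (f x)) has_derivative
      (\<lambda>h. \<Sum>b\<in>Basis. (frechet_derivative f (at x) h \<bullet> b) *\<^sub>R ?D b)) (at x)"
      using has_derivative_compose[OF Ck_on_SucD[OF Suc.prems(1) x] g] by (simp only:)
  next
    fix h
    show "Ck_on k U (\<lambda>x. \<Sum>b\<in>Basis. (frechet_derivative f (at x) h \<bullet> b) *\<^sub>R frechet_derivative g (at (f x)) b)"
    proof (intro Ck_on_sum Ck_on_scaleR assms(1) Ck_on_inner Ck_on_const)
      show "Ck_on k U (\<lambda>x. frechet_derivative f (at x) h)" using Suc.prems by simp
      show "Ck_on k U (\<lambda>x. frechet_derivative g (at (f x)) b)" for b
        by (rule Suc.IH) (use Suc.prems Ck_on_Suc_imp in \<open>auto\<close>)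
    qed
  qed
qed

lemma Ck_on_Pair:
  assumes "open U" "Ck_on k U f" "Ck_on k U g"
  shows "Ck_on k U (\<lambda>x. (f x, g x))"
proof -
  have "bounded_linear (\<lambda>a. (a, 0))" "bounded_linear (\<lambda>a. (0, a))"
    by (auto intro: bounded_linear_Pair bounded_linear_ident bounded_linear_zero)
  from Ck_on_add[OF assms(1) Ck_on_linear_compose[OF assms(1) this(1) assms(2)]
      Ck_on_linear_compose[OF assms(1) this(2) assms(3)]]
  show ?thesis by simp
qed

lemma Ck_on_fst: "open U \<Longrightarrow> Ck_on k U f \<Longrightarrow> Ck_on k U (\<lambda>x. fst (f x))"
  by (rule Ck_on_linear_compose[OF _ bounded_linear_fst])

lemma Ck_on_snd: "open U \<Longrightarrow> Ck_on k U f \<Longrightarrow> Ck_on k U (\<lambda>x. snd (f x))"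
  by (rule Ck_on_linear_compose[OF _ bounded_linear_snd])

lemma Ck_on_ident: "Ck_on k U (\<lambda>x. x)"
  by (rule Ck_on_linear[OF bounded_linear_ident])

text \<open>The derivative of the inversion is a polynomial in the inversion itself, so induction on
  the order closes without further input. The inverse square root, whose derivative is a multiple of
  its own cube, and \<open>cis\<close> are treated in the same way below.\<close>

lemma Ck_on_inverse:
  fixes f :: "'a::real_normed_vector \<Rightarrow> complex"
  assumes "open U" "Ck_on k U f" "\<And>x. x \<in> U \<Longrightarrow> f x \<noteq> 0"
  shows "Ck_on k U (\<lambda>x. inverse (f x))"
proof -
  have o: "open (- {0::complex})" by auto
  have "Ck_on k (- {0}) (inverse :: complex \<Rightarrow> complex)"
  proof (induction k)
    case 0
    then show ?case by (auto intro!: continuous_intros)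
  next
    case (Suc k)
    show ?case
    proof (rule Ck_on_SucI[OF o])
      show "(inverse has_derivative (\<lambda>h. - (inverse x * h * inverse x))) (at x)"
        if "x \<in> - {0::complex}" for x using that by (intro has_derivative_inverse') simp
      show "Ck_on k (- {0}) (\<lambda>x::complex. - (inverse x * h * inverse x))" for h
        by (intro Ck_on_minus Ck_on_mult Ck_on_const o Suc)
    qed
  qed
  moreover have "f ` U \<subseteq> - {0}"
    by (intro image_subsetI) (simp add: assms(3))
  ultimately show ?thesis by (rule Ck_on_compose[OF assms(1,2)])
qed

lemma Ck_on_divide:
  fixes f g :: "'a::real_normed_vector \<Rightarrow> complex"
  assumes "open U" "Ck_on k U f" "Ck_on k U g" "\<And>x. x \<in> U \<Longrightarrow> g x \<noteq> 0"
  shows "Ck_on k U (\<lambda>x. f x / g x)"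
  unfolding divide_inverse by (intro Ck_on_mult Ck_on_inverse assms)

lemma Ck_on_of_real:
  fixes f :: "'a::real_normed_vector \<Rightarrow> real"
  shows "open U \<Longrightarrow> Ck_on k U f \<Longrightarrow> Ck_on k U (\<lambda>x. complex_of_real (f x))"
  by (rule Ck_on_linear_compose[OF _ bounded_linear_of_real])

lemma Ck_on_inverse_sqrt:
  assumes "open U" "Ck_on k U f" "\<And>x. x \<in> U \<Longrightarrow> 0 < f x"
  shows "Ck_on k U (\<lambda>x. inverse (sqrt (f x)))"
proof -
  have o: "open {0::real<..}" by auto
  have "Ck_on k {0<..} (\<lambda>x. inverse (sqrt x))"
  proof (induction k)
    case 0
    then show ?case by (auto intro!: continuous_intros)
  next
    case (Suc k)
    show ?case
    proof (rule Ck_on_SucI[OF o])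
      show "((\<lambda>x. inverse (sqrt x)) has_derivative
          (\<lambda>h. (- h / 2) * (inverse (sqrt x) * (inverse (sqrt x) * inverse (sqrt x))))) (at x)"
        if "x \<in> {0::real<..}" for x
        using that by - ((rule derivative_eq_intros refl | simp)+, simp add: field_simps)
      show "Ck_on k {0<..} (\<lambda>x. (- h / 2) * (inverse (sqrt x) * (inverse (sqrt x) * inverse (sqrt x))))" for h
        by (intro Ck_on_mult Ck_on_const o Suc)
    qed
  qed
  moreover have "f ` U \<subseteq> {0<..}"
    by (intro image_subsetI) (simp add: assms(3))
  ultimately show ?thesis by (rule Ck_on_compose[OF assms(1,2)])
qed

lemma Ck_on_cis:
  assumes "open U" "Ck_on k U f"
  shows "Ck_on k U (\<lambda>x. cis (f x))"
proof -
  have "Ck_on k UNIV cis"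
  proof (induction k)
    case 0
    then show ?case by (auto intro!: continuous_intros)
  next
    case (Suc k)
    show ?case
    proof (rule Ck_on_SucI[OF open_UNIV])
      show "(cis has_derivative (\<lambda>h. h *\<^sub>R (\<i> * cis x))) (at x)" for x
        by (rule derivative_eq_intros refl | simp)+
      show "Ck_on k UNIV (\<lambda>x. h *\<^sub>R (\<i> * cis x))" for h
        by (intro Ck_on_mult Ck_on_scaleR Ck_on_const open_UNIV Suc)
    qed
  qed
  then show ?thesis by (rule Ck_on_compose[OF assms]) simp
qed

lemma Ck_on_Ln:
  assumes "open U" "Ck_on k U f" "\<And>x. x \<in> U \<Longrightarrow> f x \<notin> \<real>\<^sub>\<le>\<^sub>0"
  shows "Ck_on k U (\<lambda>x. Ln (f x))"
proof -
  have o: "open (- \<real>\<^sub>\<le>\<^sub>0 :: complex set)" by (simp add: open_Compl)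
  have "Ck_on k (- \<real>\<^sub>\<le>\<^sub>0) Ln"
  proof (cases k)
    case 0
    then show ?thesis by (auto intro!: continuous_intros)
  next
    case (Suc j)
    have "Ck_on (Suc j) (- \<real>\<^sub>\<le>\<^sub>0) Ln"
    proof (rule Ck_on_SucI[OF o])
      show "(Ln has_derivative (\<lambda>h. inverse x * h)) (at x)"
        if "x \<in> - \<real>\<^sub>\<le>\<^sub>0" for x
        using has_field_derivative_Ln[of x] that by (simp add: has_field_derivative_def)
      show "Ck_on j (- \<real>\<^sub>\<le>\<^sub>0) (\<lambda>x::complex. inverse x * h)" for h
        by (intro Ck_on_mult Ck_on_inverse Ck_on_ident Ck_on_const o) auto
    qed
    with Suc show ?thesis by simp
  qed
  moreover have "f ` U \<subseteq> - \<real>\<^sub>\<le>\<^sub>0"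
    by (intro image_subsetI) (simp add: assms(3))
  ultimately show ?thesis by (rule Ck_on_compose[OF assms(1,2)])
qed

section \<open>Smoothness on arbitrary subsets through local extensions\<close>

lemma smooth_on_if_Ck:
  "open U \<Longrightarrow> (\<And>k. Ck_on k U f) \<Longrightarrow> A \<subseteq> U \<Longrightarrow> smooth_on A f"
  unfolding smooth_on_def by (intro ballI exI[of _ U] exI[of _ f]) auto

lemma smooth_onE:
  assumes "smooth_on A f" "a \<in> A"
  obtains U F where "open U" "a \<in> U" "\<forall>k. Ck_on k U F" "\<forall>x\<in>A \<inter> U. F x = f x"
proof -
  from assms have "\<exists>U F. open U \<and> a \<in> U \<and> (\<forall>k. Ck_on k U F) \<and> (\<forall>x\<in>A \<inter> U. F x = f x)"
    unfolding smooth_on_def by (rule bspec)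
  then show ?thesis by (elim exE conjE) (rule that)
qed

lemma smooth_onI:
  assumes "\<And>a. a \<in> A \<Longrightarrow>
    \<exists>U F. open U \<and> a \<in> U \<and> (\<forall>k. Ck_on k U F) \<and> (\<forall>x\<in>A \<inter> U. F x = f x)"
  shows "smooth_on A f"
  unfolding smooth_on_def using assms by (rule ballI)

lemma smooth_on_cong_subset:
  assumes "smooth_on A f" "B \<subseteq> A" "\<And>x. x \<in> B \<Longrightarrow> f x = g x"
  shows "smooth_on B g"
proof (rule smooth_onI)
  fix a assume "a \<in> B"
  with assms(2) have "a \<in> A" by blast
  with assms(1) obtain U F where U: "open U" "a \<in> U" "\<forall>k. Ck_on k U F"
    "\<forall>x\<in>A \<inter> U. F x = f x" by (rule smooth_onE)
  then show "\<exists>U F. open U \<and> a \<in> U \<and> (\<forall>k. Ck_on k U F) \<and> (\<forall>x\<in>B \<inter> U. F x = g x)"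
    using assms(2,3) by (intro exI[of _ U] exI[of _ F]) auto
qed

lemmas smooth_on_subset = smooth_on_cong_subset[OF _ _ refl]
lemmas smooth_on_cong = smooth_on_cong_subset[OF _ order.refl]

lemma smooth_on_locally:
  assumes "\<And>a. a \<in> A \<Longrightarrow> \<exists>B. openin (top_of_set A) B \<and> a \<in> B \<and> smooth_on B f"
  shows "smooth_on A f"
proof (rule smooth_onI)
  fix a assume "a \<in> A"
  from assms[OF this] obtain O1 where O1: "open O1" "a \<in> O1" "smooth_on (A \<inter> O1) f"
    by (auto simp: openin_open)
  obtain U F where "open U" "a \<in> U" "\<forall>k. Ck_on k U F"
    "\<forall>x\<in>A \<inter> O1 \<inter> U. F x = f x"
    by (rule smooth_onE[OF O1(3), of a]) (use O1(2) \<open>a \<in> A\<close> in auto)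
  with O1 show "\<exists>U F. open U \<and> a \<in> U \<and> (\<forall>k. Ck_on k U F) \<and> (\<forall>x\<in>A \<inter> U. F x = f x)"
    by (intro exI[of _ "U \<inter> O1"] exI[of _ F]) (auto intro: Ck_on_subset)
qed

lemma smooth_on_compose:
  fixes f :: "'a::real_normed_vector \<Rightarrow> 'b::euclidean_space"
    and g :: "'b \<Rightarrow> 'c::real_normed_vector"
  assumes "smooth_on A f" "smooth_on B g" "f ` A \<subseteq> B"
  shows "smooth_on A (\<lambda>x. g (f x))"
proof (rule smooth_onI)
  fix a assume a: "a \<in> A"
  obtain U F where U: "open U" "a \<in> U" "\<forall>k. Ck_on k U F" "\<forall>x\<in>A \<inter> U. F x = f x"
    using assms(1) a by (rule smooth_onE)
  obtain V G where V: "open V" "f a \<in> V" "\<forall>k. Ck_on k V G" "\<forall>x\<in>B \<inter> V. G x = g x"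
    by (rule smooth_onE[OF assms(2), of "f a"]) (use assms(3) a in auto)
  have o: "open (U \<inter> F -` V)"
    using Ck_on_imp_continuous_on[OF U(3)[rule_format, of 0]] U(1) V(1) by (simp add: continuous_open_preimage)
  show "\<exists>U H. open U \<and> a \<in> U \<and> (\<forall>k. Ck_on k U H) \<and> (\<forall>x\<in>A \<inter> U. H x = g (f x))"
  proof (intro exI[of _ "U \<inter> F -` V"] exI[of _ "\<lambda>x. G (F x)"] conjI allI ballI)
    show "Ck_on k (U \<inter> F -` V) (\<lambda>x. G (F x))" for k
      by (rule Ck_on_compose[OF o Ck_on_subset[OF U(3)[rule_format]] V(3)[rule_format]]) auto
  qed (use o U V a assms(3) in auto)
qed

lemma smooth_on_imp_continuous_on:
  assumes "smooth_on A f"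
  shows "continuous_on A f"
proof (subst continuous_on_eq_continuous_within, rule ballI)
  fix a assume a: "a \<in> A"
  obtain U F where U: "open U" "a \<in> U" "\<forall>k. Ck_on k U F" "\<forall>x\<in>A \<inter> U. F x = f x"
    using assms a by (rule smooth_onE)
  then have "isCont F a"
    using Ck_on_imp_continuous_on[OF U(3)[rule_format, of 0]] by (simp add: continuous_on_eq_continuous_at)
  then have "continuous (at a within A) F" by (rule continuous_at_imp_continuous_at_within)
  then show "continuous (at a within A) f"
    by (rule continuous_transform_within_openin[where S = "A \<inter> U"]) (use U a in auto)
qed

lemma has_derivative_within_transform_open:
  assumes "(f has_derivative f') (at a within A)" "open U" "a \<in> A \<inter> U"
    and "\<And>x. x \<in> A \<inter> U \<Longrightarrow> f x = g x"
  shows "(g has_derivative f') (at a within A)"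
proof (rule has_derivative_transform_eventually[OF assms(1)])
  show "\<forall>\<^sub>F x in at a within A. f x = g x"
    unfolding eventually_at_topological using assms by (intro exI[of _ U]) auto
qed (use assms in auto)

lemma smooth_on_has_derivative_within:
  assumes "smooth_on A f" "a \<in> A"
  obtains f' where "(f has_derivative f') (at a within A)"
proof -
  obtain U F where U: "open U" "a \<in> U" "\<forall>k. Ck_on k U F" "\<forall>x\<in>A \<inter> U. F x = f x"
    using assms by (rule smooth_onE)
  then have "(F has_derivative frechet_derivative F (at a)) (at a within A)"
    using Ck_on_SucD[OF U(3)[rule_format]] by (blast intro: has_derivative_at_withinI)
  then have "(f has_derivative frechet_derivative F (at a)) (at a within A)"
    by (rule has_derivative_within_transform_open[where U = U]) (use U assms in auto)
  then show ?thesis by (rule that)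
qed

section \<open>Determinants and the half space\<close>

lemma det_4:
  "det (A::'a::comm_ring_1^4^4) =
    A$1$1 * (A$2$2 * (A$3$3 * A$4$4 - A$3$4 * A$4$3) - A$2$3 * (A$3$2 * A$4$4 - A$3$4 * A$4$2)
      + A$2$4 * (A$3$2 * A$4$3 - A$3$3 * A$4$2)) -
    A$1$2 * (A$2$1 * (A$3$3 * A$4$4 - A$3$4 * A$4$3) - A$2$3 * (A$3$1 * A$4$4 - A$3$4 * A$4$1)
      + A$2$4 * (A$3$1 * A$4$3 - A$3$3 * A$4$1)) +
    A$1$3 * (A$2$1 * (A$3$2 * A$4$4 - A$3$4 * A$4$2) - A$2$2 * (A$3$1 * A$4$4 - A$3$4 * A$4$1)
      + A$2$4 * (A$3$1 * A$4$2 - A$3$2 * A$4$1)) -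
    A$1$4 * (A$2$1 * (A$3$2 * A$4$3 - A$3$3 * A$4$2) - A$2$2 * (A$3$1 * A$4$3 - A$3$3 * A$4$1)
      + A$2$3 * (A$3$1 * A$4$2 - A$3$2 * A$4$1))"
proof -
  have f1234: "finite {2::4, 3, 4}" "1 \<notin> {2::4, 3, 4}"
    and f234: "finite {3::4, 4}" "2 \<notin> {3::4, 4}"
    and f34: "finite {4::4}" "3 \<notin> {4::4}"
    by auto
  show ?thesis
    unfolding det_def UNIV_4
    unfolding sum_over_permutations_insert[OF f1234]
    unfolding sum_over_permutations_insert[OF f234]
    unfolding sum_over_permutations_insert[OF f34]
    unfolding permutes_sing
    by (simp add: sign_swap_id permutation_swap_id permutation_compose sign_compose sign_id swap_id_eq algebra_simps)
qed

text \<open>Meant for the Jacobian of a transition map at a boundary point, where \<open>B\<close>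
  is the Jacobian of the induced map of the boundary.\<close>

lemma det_block_4:
  fixes A :: "'a::comm_ring_1^4^4" and B :: "'a^3^3"
  assumes "A $ 1 $ 2 = 0" "A $ 1 $ 3 = 0" "A $ 1 $ 4 = 0"
    and "B $ 1 $ 1 = A $ 2 $ 2" "B $ 1 $ 2 = A $ 2 $ 3" "B $ 1 $ 3 = A $ 2 $ 4"
    "B $ 2 $ 1 = A $ 3 $ 2" "B $ 2 $ 2 = A $ 3 $ 3" "B $ 2 $ 3 = A $ 3 $ 4"
    "B $ 3 $ 1 = A $ 4 $ 2" "B $ 3 $ 2 = A $ 4 $ 3" "B $ 3 $ 3 = A $ 4 $ 4"
  shows "det A = A $ 1 $ 1 * det B"
  unfolding det_4 det_3 using assms by (simp add: algebra_simps)

text \<open>The matrix is a I + b z z^T, with eigenvalue a on the complement of z and a + b |z|^2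
  along z.\<close>

lemma det_rank_one_update_4:
  fixes z :: "real^4"
  assumes "\<And>i j. A $ i $ j = (if i = j then a else 0) + b * z $ i * z $ j"
  shows "det A = a ^ 3 * (a + b * (z \<bullet> z))"
  by (simp add: det_4 assms inner_vec_def sum_4 algebra_simps power3_eq_cube)

definition bdry :: "real^3 \<Rightarrow> real^4" where
  "bdry y = vector [0, y $ 1, y $ 2, y $ 3]"

definition tail3 :: "real^4 \<Rightarrow> real^3" where
  "tail3 x = vector [x $ 2, x $ 3, x $ 4]"

lemma vector_4 [simp]:
  "(vector [a, b, c, d] :: 'a::zero^4) $ 1 = a"
  "(vector [a, b, c, d] :: 'a::zero^4) $ 2 = b"
  "(vector [a, b, c, d] :: 'a::zero^4) $ 3 = c"
  "(vector [a, b, c, d] :: 'a::zero^4) $ 4 = d"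
  unfolding vector_def by simp_all

lemma bdry_nth [simp]: "bdry y $ 1 = 0" "bdry y $ 2 = y $ 1" "bdry y $ 3 = y $ 2" "bdry y $ 4 = y $ 3"
  by (simp_all add: bdry_def)

lemma tail3_nth [simp]: "tail3 x $ 1 = x $ 2" "tail3 x $ 2 = x $ 3" "tail3 x $ 3 = x $ 4"
  by (simp_all add: tail3_def)

lemma tail3_bdry [simp]: "tail3 (bdry y) = y"
  by (simp add: vec_eq_iff forall_3)

lemma bdry_tail3: "x $ 1 = 0 \<Longrightarrow> bdry (tail3 x) = x"
  by (simp add: vec_eq_iff forall_4)

lemma bounded_linear_bdry: "bounded_linear bdry"
  by (intro linear_conv_bounded_linear[THEN iffD1] linearI) (simp_all add: vec_eq_iff forall_4)

lemma bounded_linear_tail3: "bounded_linear tail3"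
  by (intro linear_conv_bounded_linear[THEN iffD1] linearI) (simp_all add: vec_eq_iff forall_3)

lemma boundary_atlas_eq:
  "boundary_atlas A = (\<lambda>(D, p). (bdry -` D, p \<circ> bdry)) ` A"
  by (simp add: boundary_atlas_def vimage_def comp_def bdry_def[abs_def])

lemma bdry_in_half_space [simp]: "bdry y \<in> half_space4"
  by (simp add: half_space4_def)

section \<open>Uniqueness of derivatives at boundary points\<close>

lemma at_within_openin:
  assumes "openin (top_of_set A) D" "x \<in> D"
  shows "at x within D = at x within A"
proof -
  obtain U where U: "open U" "D = A \<inter> U" using assms(1) by (auto simp: openin_open)
  show ?thesis by (rule at_within_nhd[of x U]) (use U assms(2) in auto)
qed

text \<open>Uniqueness needs, for each basis vector, arbitrarily short nonzero steps of some sign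
  that stay in the set. A step along a negative multiple of a basis vector never raises the first
  coordinate.\<close>

lemma has_derivative_unique_half_space4:
  fixes f :: "real^4 \<Rightarrow> 'b::real_normed_vector"
  assumes "(f has_derivative f') (at x within half_space4)"
    and "(f has_derivative f'') (at x within half_space4)" "x \<in> half_space4"
  shows "f' = f''"
proof (rule frechet_derivative_unique_within[OF assms(1,2)])
  fix i :: "real^4" and e :: real
  assume i: "i \<in> Basis" and e: "0 < e"
  have "0 \<le> i $ 1" using i by (auto simp: Basis_vec_def axis_def)
  then have "0 \<le> e / 2 * i $ 1" using e by (intro mult_nonneg_nonneg) auto
  moreover have "(x + (- e / 2) *\<^sub>R i) $ 1 = x $ 1 - e / 2 * i $ 1" by simp
  ultimately have "x + (- e / 2) *\<^sub>R i \<in> half_space4"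
    using assms(3) unfolding half_space4_def mem_Collect_eq by linarith
  then show "\<exists>d. 0 < \<bar>d\<bar> \<and> \<bar>d\<bar> < e \<and> x + d *\<^sub>R i \<in> half_space4"
    using e by (intro exI[of _ "- e / 2"]) auto
qed

text \<open>At a point of the sphere the admissible step depends on the basis vector
  \<open>i\<close>: the sign of \<open>d\<close> is taken so that \<open>d * (x \<bullet> i)\<close>
  is nonnegative, and then the norm cannot decrease.\<close>

lemma has_derivative_unique_ball_complement:
  fixes f :: "'a::euclidean_space \<Rightarrow> 'b::real_normed_vector"
  assumes "(f has_derivative f') (at x within {z. 1 \<le> norm z})"
    and "(f has_derivative f'') (at x within {z. 1 \<le> norm z})" "1 \<le> norm x"
  shows "f' = f''"
proof (rule frechet_derivative_unique_within[OF assms(1,2)])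
  fix i :: 'a and e :: real
  assume i: "i \<in> Basis" and e: "0 < e"
  define d where "d = (if 0 \<le> x \<bullet> i then e / 2 else - e / 2)"
  have "0 \<le> d * (x \<bullet> i)" using e by (auto simp: d_def mult_le_0_iff)
  then have "norm x ^ 2 \<le> norm (x + d *\<^sub>R i) ^ 2"
    using i by (simp add: power2_norm_eq_inner inner_simps inner_commute[of i x] distrib_left)
  then have "norm x \<le> norm (x + d *\<^sub>R i)" by (rule power2_le_imp_le) simp
  then show "\<exists>d. 0 < \<bar>d\<bar> \<and> \<bar>d\<bar> < e \<and> x + d *\<^sub>R i \<in> {z. 1 \<le> norm z}"
    using e assms(3) by (intro exI[of _ d]) (auto simp: d_def)
qed

section \<open>Parametrizations respect boundaries\<close>

lemma local_paramsD:
  assumes "(D, g) \<in> local_params X"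
  shows "openin (top_of_set half_space4) D" "openin (top_of_set X) (g ` D)" "inj_on g D"
    "smooth_on D g" "smooth_on (g ` D) (the_inv_into D g)" "D \<subseteq> half_space4" "g ` D \<subseteq> X"
proof -
  show "openin (top_of_set half_space4) D" "openin (top_of_set X) (g ` D)" "inj_on g D"
    "smooth_on D g" "smooth_on (g ` D) (the_inv_into D g)"
    using assms by (simp_all add: local_params_def)
  then show "D \<subseteq> half_space4" "g ` D \<subseteq> X" by (auto dest: openin_imp_subset)
qed

text \<open>Differentiating inverse after parametrization within the half space yields a left
  inverse \<open>B\<close> of \<open>A\<close>. For general \<open>X\<close> nothing more can be
  expected: \<open>blowup_cover\<close> lies in a space of real dimension five, where
  \<open>A\<close> cannot be onto.\<close>

lemma local_params_derivatives:
  fixes X :: "'e::euclidean_space set"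
  assumes "(D, g) \<in> local_params X" "x \<in> D"
  obtains A B where "(g has_derivative A) (at x within half_space4)"
    "(the_inv_into D g has_derivative B) (at (g x) within X)"
    "\<And>v. B (A v) = v"
proof -
  note P = local_paramsD[OF assms(1)]
  let ?h = "the_inv_into D g"
  have gx: "g x \<in> g ` D" using assms(2) by blast
  obtain A where A: "(g has_derivative A) (at x within D)"
    using smooth_on_has_derivative_within[OF P(4) assms(2)] by metis
  obtain B where B: "(?h has_derivative B) (at (g x) within g ` D)"
    using smooth_on_has_derivative_within[OF P(5) gx] by metis
  have "((\<lambda>x. x) has_derivative B \<circ> A) (at x within D)"
    by (rule has_derivative_within_transform_open[OF diff_chain_within[OF A B] open_UNIV])
      (use assms(2) P(3) in \<open>auto simp: the_inv_into_f_f\<close>)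
  then have "B \<circ> A = (\<lambda>x. x)"
    using has_derivative_unique_half_space4[of "\<lambda>x. x"] P(6) assms(2)
      at_within_openin[OF P(1) assms(2)] has_derivative_ident by (metis subsetD)
  then have "B (A v) = v" for v by (metis comp_apply)
  then show ?thesis
    using that A B at_within_openin[OF P(1) assms(2)] at_within_openin[OF P(2) gx] by metis
qed

text \<open>Otherwise the first coordinate of the inverse parametrization would be differentiable
  near an interior point of \<open>X\<close> and have its maximum 0 there, so its differential would
  vanish. But \<open>B (A (axis 1 1))\<close> has first coordinate 1. With \<open>X = UNIV\<close>
  this keeps affine charts of the blow-up away from the boundary.\<close>

lemma local_params_boundary_notin_interior:
  assumes "(D, g) \<in> local_params X" "x \<in> D" "x $ 1 = 0"
  shows "g x \<notin> interior X"
proof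
  assume int: "g x \<in> interior X"
  note P = local_paramsD[OF assms(1)]
  let ?h = "the_inv_into D g"
  obtain A B where AB: "(g has_derivative A) (at x within half_space4)"
    "(?h has_derivative B) (at (g x) within X)" "\<And>v. B (A v) = v"
    using local_params_derivatives[OF assms(1,2)] by metis
  obtain U where U: "open U" "g ` D = X \<inter> U" using P(2) by (auto simp: openin_open)
  have S: "g x \<in> interior X \<inter> U" "open (interior X \<inter> U)" "interior X \<inter> U \<subseteq> g ` D"
    using int U assms(2) interior_subset[of X] by auto
  have B: "(?h has_derivative B) (at (g x))"
    using AB(2) at_within_interior[OF int] by simp
  then have "((\<lambda>z. ?h z $ 1) has_derivative (\<lambda>v. B v $ 1)) (at (g x))"
    by (rule bounded_linear.has_derivative[OF bounded_linear_vec_nth])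
  moreover have "?h z $ 1 \<le> ?h (g x) $ 1" if "z \<in> interior X \<inter> U" for z
  proof -
    have "?h z \<in> D" using that S(3) P(3) by (intro the_inv_into_into) auto
    then show ?thesis
      using P(3,6) assms(2,3) by (auto simp: the_inv_into_f_f half_space4_def)
  qed
  ultimately have "(\<lambda>v. B v $ 1) = (\<lambda>v. 0)"
    by (intro differential_zero_maxmin[OF S(1,2)]) auto
  then have "B (A (axis 1 1)) $ 1 = 0" by metis
  with AB(3) show False by (simp add: axis_def)
qed

text \<open>One direction is the previous lemma. For the other, an interior parameter mapped to the
  sphere would minimize the squared norm of \<open>g\<close>, so that its differential vanishes; in
  a direction that \<open>A\<close> carries to \<open>g x\<close> it equals 2 instead. Boundary
  points are thus recognized by the norm of their image alone.\<close>

lemma local_params_ball_complement_norm: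
  fixes g :: "real^4 \<Rightarrow> 'e::euclidean_space"
  assumes "(D, g) \<in> local_params {z. 1 \<le> norm z}" "x \<in> D"
  shows "norm (g x) = 1 \<longleftrightarrow> x $ 1 = 0"
proof
  note P = local_paramsD[OF assms(1)]
  let ?h = "the_inv_into D g"
  let ?X = "{z::'e. 1 \<le> norm z}"
  have x: "x $ 1 \<le> 0" using P(6) assms(2) by (auto simp: half_space4_def)
  have gx: "1 \<le> norm (g x)" using P(7) assms(2) by auto
  show "norm (g x) = 1" if "x $ 1 = 0"
  proof (rule ccontr)
    assume "norm (g x) \<noteq> 1"
    then have "g x \<in> {z. 1 < norm z}" using gx by simp
    moreover have "open {z::'e. 1 < norm z}" by (intro open_Collect_less continuous_intros)
    ultimately have "g x \<in> interior ?X" by (auto intro!: interiorI)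
    then show False using local_params_boundary_notin_interior[OF assms that] by blast
  qed
  show "x $ 1 = 0" if n: "norm (g x) = 1"
  proof (rule ccontr)
    assume "x $ 1 \<noteq> 0"
    then have x: "x $ 1 < 0" using x by simp
    obtain A B where AB: "(g has_derivative A) (at x within half_space4)"
      "(?h has_derivative B) (at (g x) within ?X)" "\<And>v. B (A v) = v"
      using local_params_derivatives[OF assms] by metis
    have gxD: "g x \<in> g ` D" using assms(2) by blast
    have "(?h has_derivative B) (at (g x) within g ` D)"
      using AB(2) at_within_openin[OF P(2) gxD] by simp
    moreover have "?h ` (g ` D) = D" using P(3) by (auto simp: the_inv_into_f_f image_iff)
    moreover have hgx: "?h (g x) = x" using P(3) assms(2) by (simp add: the_inv_into_f_f)
    ultimately have "((g \<circ> ?h) has_derivative A \<circ> B) (at (g x) within g ` D)"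
      using AB(1) at_within_openin[OF P(1) assms(2)] by (intro diff_chain_within) auto
    then have "((\<lambda>z. z) has_derivative A \<circ> B) (at (g x) within g ` D)"
      by (rule has_derivative_within_transform_open[OF _ open_UNIV])
        (use gxD P(3) in \<open>auto simp: f_the_inv_into_f\<close>)
    then have "((\<lambda>z. z) has_derivative A \<circ> B) (at (g x) within ?X)"
      using at_within_openin[OF P(2) gxD] by simp
    \<comment> \<open>The composite in this order needs uniqueness of derivatives within the ball
      complement, at a point of the sphere. It shows that the radial direction \<open>g x\<close> is
      in the range of \<open>A\<close>.\<close>
    then have "A \<circ> B = (\<lambda>z. z)"
      by (rule has_derivative_unique_ball_complement[OF _ has_derivative_ident gx])
    then have "A (B (g x)) = g x" by (metis comp_apply)
    obtain U where U: "open U" "D = half_space4 \<inter> U" using P(1) by (auto simp: openin_open)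
    have "open {x::real^4. x $ 1 < 0}" by (intro open_Collect_less continuous_intros)
    then have S: "open ({x. x $ 1 < 0} \<inter> U)" "x \<in> {x. x $ 1 < 0} \<inter> U" "{x. x $ 1 < 0} \<inter> U \<subseteq> D"
      using U x assms(2) by (auto simp: half_space4_def)
    have "x \<in> interior half_space4"
      by (rule interiorI[OF \<open>open {x::real^4. x $ 1 < 0}\<close>]) (use x in \<open>auto simp: half_space4_def\<close>)
    then have "(g has_derivative A) (at x)" using AB(1) at_within_interior by metis
    then have "((\<lambda>y. g y \<bullet> g y) has_derivative (\<lambda>v. g x \<bullet> A v + A v \<bullet> g x)) (at x)"
      by (intro has_derivative_inner)
    moreover have "g x \<bullet> g x \<le> g y \<bullet> g y" if "y \<in> {x. x $ 1 < 0} \<inter> U" for y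
    proof -
      have "1 \<le> norm (g y)" using that S(3) P(7) by auto
      then have "1\<^sup>2 \<le> (norm (g y))\<^sup>2" by (intro power_mono) auto
      then show ?thesis using n by (simp add: dot_square_norm)
    qed
    ultimately have "(\<lambda>v. g x \<bullet> A v + A v \<bullet> g x) = (\<lambda>v. 0)"
      by (intro differential_zero_maxmin[OF S(2,1)]) auto
    then have "g x \<bullet> A (B (g x)) + A (B (g x)) \<bullet> g x = 0" by metis
    with \<open>A (B (g x)) = g x\<close> n show False by (simp add: dot_square_norm)
  qed
qed

section \<open>Transition maps\<close>

text \<open>The transition map is only defined on a relatively open piece of the half space.
  \<open>F\<close> is a smooth extension to a full neighbourhood in four-space, and its chart
  relations are claimed on the half space only.\<close>

lemma local_params_transition:
  fixes X :: "'e::euclidean_space set"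
  assumes "(D, g) \<in> local_params X" "(D', g') \<in> local_params X" "x0 \<in> D" "g x0 \<in> g' ` D'"
  obtains U F where "open U" "x0 \<in> U" "\<And>k. Ck_on k U F"
    "\<And>x. x \<in> half_space4 \<Longrightarrow> x \<in> U \<Longrightarrow> x \<in> D \<and> F x \<in> D' \<and> g' (F x) = g x"
proof -
  note P = local_paramsD[OF assms(1)] and P' = local_paramsD[OF assms(2)]
  define N where "N = D \<inter> g -` (g' ` D')"
  obtain O' where O': "open O'" "g' ` D' = X \<inter> O'" using P'(2) by (auto simp: openin_open)
  have N_eq: "N = D \<inter> g -` O'" using O' P(7) by (auto simp: N_def)
  have "openin (top_of_set D) (D \<inter> g -` O')"
    by (rule continuous_openin_preimage_gen[OF smooth_on_imp_continuous_on[OF P(4)] O'(1)])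
  then have "openin (top_of_set half_space4) N"
    unfolding N_eq using P(1) openin_trans by blast
  then obtain V where V: "open V" "N = half_space4 \<inter> V" by (auto simp: openin_open)
  have "smooth_on N (\<lambda>x. the_inv_into D' g' (g x))"
    by (rule smooth_on_compose[OF smooth_on_subset[OF P(4)] P'(5)]) (auto simp: N_def)
  moreover have x0: "x0 \<in> N" using assms(3,4) by (simp add: N_def)
  ultimately obtain U F where U: "open U" "x0 \<in> U" "\<forall>k. Ck_on k U F"
    "\<forall>x\<in>N \<inter> U. F x = the_inv_into D' g' (g x)"
    by (rule smooth_onE)
  show ?thesis
  proof (rule that[of "U \<inter> V" F])
    show "open (U \<inter> V)" "x0 \<in> U \<inter> V" using U V x0 by auto
    show "Ck_on k (U \<inter> V) F" for k using U(3) by (auto intro: Ck_on_subset)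
    fix x assume "x \<in> half_space4" "x \<in> U \<inter> V"
    then have x: "x \<in> N" "F x = the_inv_into D' g' (g x)" using U V by auto
    then show "x \<in> D \<and> F x \<in> D' \<and> g' (F x) = g x"
      using P'(3) by (auto simp: N_def intro!: the_inv_into_into f_the_inv_into_f)
  qed
qed

lemma bdry_transition:
  fixes g g' :: "real^4 \<Rightarrow> 'e::euclidean_space"
  assumes "(D, g) \<in> local_params {z. 1 \<le> norm z}" "(D', g') \<in> local_params {z. 1 \<le> norm z}"
    and "\<And>x. x \<in> half_space4 \<Longrightarrow> x \<in> U \<Longrightarrow> x \<in> D \<and> F x \<in> D' \<and> g' (F x) = g x"
    and "bdry y \<in> U"
  shows "F (bdry y) $ 1 = 0" "bdry (tail3 (F (bdry y))) = F (bdry y)"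
proof -
  from assms(3)[OF bdry_in_half_space assms(4)]
  have F: "bdry y \<in> D" "F (bdry y) \<in> D'" "g' (F (bdry y)) = g (bdry y)" by auto
  have "norm (g (bdry y)) = 1"
    using local_params_ball_complement_norm[OF assms(1) F(1)] by simp
  then show "F (bdry y) $ 1 = 0"
    using local_params_ball_complement_norm[OF assms(2) F(2)] F(3) by simp
  then show "bdry (tail3 (F (bdry y))) = F (bdry y)" by (rule bdry_tail3)
qed

lemma open_vimage_bdry: "open U \<Longrightarrow> open (bdry -` U)"
  by (rule open_vimage[OF _ linear_continuous_on[OF bounded_linear_bdry]])

lemma Ck_on_bdry_transition:
  assumes "open U" "Ck_on k U F"
  shows "Ck_on k (bdry -` U) (\<lambda>y. tail3 (F (bdry y)))"
  by (intro Ck_on_linear_compose[OF _ bounded_linear_tail3]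
      Ck_on_compose[OF _ Ck_on_linear[OF bounded_linear_bdry] assms(2)] open_vimage_bdry assms(1)) auto

text \<open>Restricting \<open>F\<close> to the face gives a map of three-space because
  \<open>F\<close> keeps the first coordinate equal to 0: corresponding points have the same image,
  and its norm decides whether they lie on the face. \<open>K\<close> is smooth on an honest open
  set, so ordinary derivatives are available for it.\<close>

lemma boundary_transition:
  fixes g g' :: "real^4 \<Rightarrow> 'e::euclidean_space"
  assumes "(D, g) \<in> local_params {z. 1 \<le> norm z}" "(D', g') \<in> local_params {z. 1 \<le> norm z}"
    and "bdry y0 \<in> D" "g (bdry y0) \<in> g' ` D'"
  obtains W K where "open W" "y0 \<in> W" "\<And>k. Ck_on k W K"
    "\<And>y. y \<in> W \<Longrightarrow> bdry y \<in> D \<and> bdry (K y) \<in> D' \<and> g' (bdry (K y)) = g (bdry y)"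
proof -
  from assms obtain U F where U: "open U" "bdry y0 \<in> U" "\<And>k. Ck_on k U F"
    and F: "\<And>x. x \<in> half_space4 \<Longrightarrow> x \<in> U \<Longrightarrow> x \<in> D \<and> F x \<in> D' \<and> g' (F x) = g x"
    using local_params_transition[of D g "{z. 1 \<le> norm z}" D' g' "bdry y0"] by metis
  show ?thesis
  proof (rule that[of "bdry -` U" "\<lambda>y. tail3 (F (bdry y))"])
    show "bdry y \<in> D \<and> bdry (tail3 (F (bdry y))) \<in> D' \<and> g' (bdry (tail3 (F (bdry y)))) = g (bdry y)"
      if "y \<in> bdry -` U" for y
      using that bdry_transition[OF assms(1,2) F, where y = y] F[of "bdry y"] by simp
  qed (use U in \<open>simp_all add: open_vimage_bdry Ck_on_bdry_transition\<close>)
qed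

section \<open>Jacobian determinants of transition maps\<close>

lemma det_matrix_compose:
  fixes f :: "real^'n::finite \<Rightarrow> real^'n" and g :: "real^'n \<Rightarrow> real^'n"
  assumes "bounded_linear f" "bounded_linear g"
  shows "det (matrix (\<lambda>v. g (f v))) = det (matrix g) * det (matrix f)"
  using matrix_compose[of f g] assms
  by (simp add: bounded_linear.linear det_mul o_def)

lemma half_space4_translate:
  "x \<in> half_space4 \<Longrightarrow> 0 < s \<Longrightarrow> (x - s *\<^sub>R axis 1 1) $ 1 < 0"
  by (simp add: half_space4_def axis_def)

lemma open_interior_half_space4: "open {x::real^4. x $ 1 < 0}"
  by (intro open_Collect_less continuous_intros)

lemma interior_half_space4_mem: "x $ 1 < 0 \<Longrightarrow> x \<in> half_space4"
  by (simp add: half_space4_def)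

lemma local_params_differentiable_interior:
  assumes "(D, g) \<in> local_params X" "x \<in> D" "x $ 1 < 0"
  shows "g differentiable (at x)"
proof -
  obtain A B where A: "(g has_derivative A) (at x within half_space4)"
    using local_params_derivatives[OF assms(1,2)] by metis
  have "x \<in> interior half_space4"
    by (rule interiorI[OF open_interior_half_space4]) (use assms in \<open>auto simp: half_space4_def\<close>)
  then show ?thesis using A at_within_interior differentiable_def by metis
qed

lemma bounded_linear_real_coords: "bounded_linear real_coords"
  by (intro linear_conv_bounded_linear[THEN iffD1] linearI)
    (simp_all add: vec_eq_iff forall_4 real_coords_def)

lemma norm_real_coords [simp]: "norm (real_coords z) = norm z"
  by (cases z) (simp add: norm_vec_def L2_set_def sum_4 real_coords_def norm_Pair cmod_power2 add.assoc)

lemma transition_derivative_det: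
  fixes g g' :: "real^4 \<Rightarrow> complex \<times> complex"
  assumes g: "(D, g) \<in> local_params X" and g': "(D', g') \<in> local_params X"
    and U: "open U" "Ck_on 1 U F"
      "\<And>x. x \<in> half_space4 \<Longrightarrow> x \<in> U \<Longrightarrow> x \<in> D \<and> F x \<in> D' \<and> g' (F x) = g x"
    and x: "x \<in> U" "x $ 1 < 0" "F x $ 1 < 0"
  shows "det (matrix (frechet_derivative (\<lambda>x. real_coords (g x)) (at x))) =
    det (matrix (frechet_derivative (\<lambda>x. real_coords (g' x)) (at (F x)))) *
    det (matrix (frechet_derivative F (at x)))"
proof -
  let ?P = "frechet_derivative F (at x)"
  let ?Q = "frechet_derivative (\<lambda>x. real_coords (g' x)) (at (F x))"
  from U(3)[OF interior_half_space4_mem[OF x(2)] x(1)] have "F x \<in> D'" by blast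
  have F: "(F has_derivative ?P) (at x)"
    using U(2) x(1) by (simp add: frechet_derivative_works)
  have "(\<lambda>x. real_coords (g' x)) differentiable (at (F x))"
    using local_params_differentiable_interior[OF g' \<open>F x \<in> D'\<close> x(3)]
      bounded_linear.has_derivative[OF bounded_linear_real_coords]
    unfolding differentiable_def by blast
  then have Q: "((\<lambda>x. real_coords (g' x)) has_derivative ?Q) (at (F x))"
    by (simp add: frechet_derivative_works)
  have "((\<lambda>x. real_coords (g x)) has_derivative (\<lambda>v. ?Q (?P v))) (at x)"
  proof (rule has_derivative_transform_within_open[OF has_derivative_compose[OF F Q]])
    show "open (U \<inter> {x. x $ 1 < 0})" using U(1) open_interior_half_space4 by blast
  qed (use x U(3) interior_half_space4_mem in auto)
  from frechet_derivative_at[OF this, symmetric] show ?thesis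
    using det_matrix_compose has_derivative_bounded_linear F Q by metis
qed

text \<open>\<open>G\<close> is the transition map in the opposite direction. The relation
  \<open>G (F z) = z\<close> is known on the half space only, yet derivatives within the half space
  are unique, so the full derivatives are inverse to each other even at a boundary point. There the
  signs at interior points alone would only give a weak inequality in the limit.\<close>

lemma transition_det_nonzero:
  fixes g g' :: "real^4 \<Rightarrow> 'e::euclidean_space"
  assumes g: "(D, g) \<in> local_params X" and g': "(D', g') \<in> local_params X"
    and U: "open U" "Ck_on 1 U F"
      "\<And>x. x \<in> half_space4 \<Longrightarrow> x \<in> U \<Longrightarrow> x \<in> D \<and> F x \<in> D' \<and> g' (F x) = g x"
    and x: "x \<in> U" "x \<in> half_space4"
  shows "det (matrix (frechet_derivative F (at x))) \<noteq> 0"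
proof -
  let ?P = "frechet_derivative F (at x)"
  from U(3)[OF x(2,1)] have Fx: "x \<in> D" "F x \<in> D'" "g' (F x) \<in> g ` D" by auto
  obtain V G where V: "open V" "F x \<in> V" "\<And>k. Ck_on k V G"
    and G: "\<And>x. x \<in> half_space4 \<Longrightarrow> x \<in> V \<Longrightarrow> x \<in> D' \<and> G x \<in> D \<and> g (G x) = g' x"
    using local_params_transition[OF g' g Fx(2,3)] by metis
  let ?Q = "frechet_derivative G (at (F x))"
  have F: "(F has_derivative ?P) (at x)"
    using U(2) x(1) by (simp add: frechet_derivative_works)
  have Q: "(G has_derivative ?Q) (at (F x))"
    by (rule Ck_on_SucD[OF V(3) V(2)])
  have o: "open (U \<inter> F -` V)"
    using Ck_on_imp_continuous_on[OF U(2)] U(1) V(1) by (simp add: continuous_open_preimage)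
  have "((\<lambda>x. x) has_derivative (\<lambda>v. ?Q (?P v))) (at x within half_space4)"
  proof (rule has_derivative_within_transform_open[OF _ o])
    show "((\<lambda>x. G (F x)) has_derivative (\<lambda>v. ?Q (?P v))) (at x within half_space4)"
      by (rule has_derivative_at_withinI[OF has_derivative_compose[OF F Q]])
    show "x \<in> half_space4 \<inter> (U \<inter> F -` V)" using x V by simp
    fix z assume z: "z \<in> half_space4 \<inter> (U \<inter> F -` V)"
    then have z': "z \<in> D" "F z \<in> D'" "g' (F z) = g z" using U(3)[of z] by auto
    then have "F z \<in> half_space4" using local_paramsD(6)[OF g'] by blast
    then have "G (F z) \<in> D" "g (G (F z)) = g z" using G[of "F z"] z z' by auto
    then show "G (F z) = z" using local_paramsD(3)[OF g] z'(1) by (auto dest: inj_onD)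
  qed
  then have "(\<lambda>v. ?Q (?P v)) = (\<lambda>x. x)"
    by (rule has_derivative_unique_half_space4[OF _ has_derivative_ident x(2)])
  then have "det (matrix ?Q) * det (matrix ?P) = det (matrix (\<lambda>x::real^4. x))"
    using det_matrix_compose has_derivative_bounded_linear F Q by metis
  then show ?thesis by (auto simp: matrix_id_mat_1[unfolded id_def])
qed

text \<open>At a boundary point the first row of the Jacobian matrix of \<open>F\<close> is \<open>(a, 0, 0, 0)\<close> with \<open>a \<ge> 0\<close>,
  since \<open>F\<close> preserves the half space and its boundary; so the sign passes to the lower right block.\<close>

lemma boundary_transition_det_neg:
  fixes F :: "real^4 \<Rightarrow> real^4"
  assumes U: "open U" "bdry y0 \<in> U" "Ck_on 1 U F"
    and bd: "\<And>y. bdry y \<in> U \<Longrightarrow> F (bdry y) $ 1 = 0"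
    and half: "\<And>x. x \<in> U \<Longrightarrow> x $ 1 < 0 \<Longrightarrow> F x $ 1 < 0"
    and neg: "\<And>x. x \<in> U \<Longrightarrow> x $ 1 < 0 \<Longrightarrow> det (matrix (frechet_derivative F (at x))) < 0"
    and nz: "det (matrix (frechet_derivative F (at (bdry y0)))) \<noteq> 0"
  shows "det (matrix (frechet_derivative (\<lambda>y. tail3 (F (bdry y))) (at y0))) < 0"
proof -
  let ?x = "bdry y0"
  let ?P = "frechet_derivative F (at ?x)"
  let ?d = "\<lambda>x. det (matrix (frechet_derivative F (at x)))"
  have F: "(F has_derivative ?P) (at ?x)"
    using U(2,3) by (simp add: frechet_derivative_works)
  interpret P: bounded_linear ?P using F by (rule has_derivative_bounded_linear)
  \<comment> \<open>Points pushed slightly inwards from the face: they are interior, where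
    \<open>half\<close> and \<open>neg\<close> apply, and enter every neighbourhood of
    \<open>?x\<close>.\<close>
  have near: "\<exists>s>0. s < \<delta> \<and> ?x - s *\<^sub>R axis 1 1 \<in> S"
    if S: "open S" "?x \<in> S" and \<delta>: "0 < \<delta>" for S :: "(real^4) set" and \<delta> :: real
  proof -
    obtain e where e: "e > 0" "ball ?x e \<subseteq> S" using S openE by metis
    then show ?thesis
      using \<delta> by (intro exI[of _ "min e \<delta> / 2"]) (auto simp: dist_norm subset_iff)
  qed
  \<comment> \<open>The determinant is continuous on \<open>U\<close> and negative at interior
    points arbitrarily close to \<open>?x\<close>; strictness then comes from
    \<open>nz\<close>.\<close>
  have "?d ?x \<le> 0"
  proof (rule ccontr)
    assume "\<not> ?d ?x \<le> 0"
    have c: "continuous_on U ?d"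
      unfolding det_def matrix_def using U(3)
      by (auto intro!: continuous_intros)
    have "open (U \<inter> ?d -` {0<..})" by (rule continuous_open_preimage[OF c U(1)]) auto
    moreover have "?x \<in> U \<inter> ?d -` {0<..}" using U(2) \<open>\<not> ?d ?x \<le> 0\<close> by auto
    ultimately obtain s where s: "0 < s" "?x - s *\<^sub>R axis 1 1 \<in> U \<inter> ?d -` {0<..}"
      using near[of _ 1] by (metis zero_less_one)
    moreover have "(?x - s *\<^sub>R axis 1 1) $ 1 < 0"
      by (rule half_space4_translate[OF bdry_in_half_space s(1)])
    ultimately show False using neg[of "?x - s *\<^sub>R axis 1 1"] by auto
  qed
  with nz have neg0: "?d ?x < 0" by simp
  have 0: "?P (bdry v) $ 1 = 0" for v
  proof -
    have "((\<lambda>y. F (bdry y) $ 1) has_derivative (\<lambda>v. ?P (bdry v) $ 1)) (at y0)"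
      by (intro bounded_linear.has_derivative[OF bounded_linear_vec_nth]
          has_derivative_compose[OF bounded_linear_imp_has_derivative[OF bounded_linear_bdry] F])
    moreover have "open (bdry -` U)" by (rule open_vimage_bdry[OF U(1)])
    ultimately have "((\<lambda>y. 0) has_derivative (\<lambda>v. ?P (bdry v) $ 1)) (at y0)"
      by (rule has_derivative_transform_within_open) (use U bd in auto)
    then have "(\<lambda>v. ?P (bdry v) $ 1) = (\<lambda>v. 0)"
      using has_derivative_unique has_derivative_const by blast
    then show ?thesis by metis
  qed
  have b: "bdry (axis 1 1) = axis 2 1" "bdry (axis 2 1) = axis 3 1" "bdry (axis 3 1) = axis 4 1"
    by (simp_all add: vec_eq_iff forall_4 axis_def)
  have K: "((\<lambda>y. tail3 (F (bdry y))) has_derivative (\<lambda>v. tail3 (?P (bdry v)))) (at y0)"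
    by (intro bounded_linear.has_derivative[OF bounded_linear_tail3]
          has_derivative_compose[OF bounded_linear_imp_has_derivative[OF bounded_linear_bdry] F])
  have "?d ?x = ?P (axis 1 1) $ 1 * det (matrix (\<lambda>v. tail3 (?P (bdry v))))"
    by (subst det_block_4[where B = "matrix (\<lambda>v. tail3 (?P (bdry v)))"])
      (use 0[of "axis 1 1"] 0[of "axis 2 1"] 0[of "axis 3 1"] in \<open>simp_all add: b matrix_def\<close>)
  moreover have "0 \<le> ?P (axis 1 1) $ 1"
  proof (rule ccontr)
    assume "\<not> 0 \<le> ?P (axis 1 1) $ 1"
    moreover have "((\<lambda>s. F (?x + s *\<^sub>R axis 1 1) $ 1) has_derivative (\<lambda>s. ?P (s *\<^sub>R axis 1 1) $ 1)) (at 0)"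
    proof (intro bounded_linear.has_derivative[OF bounded_linear_vec_nth])
      have "((\<lambda>s. ?x + s *\<^sub>R axis 1 1) has_derivative (\<lambda>s. s *\<^sub>R axis 1 1)) (at 0)"
        by (auto intro!: derivative_eq_intros)
      then show "((\<lambda>s. F (?x + s *\<^sub>R axis 1 1)) has_derivative (\<lambda>s. ?P (s *\<^sub>R axis 1 1))) (at 0)"
        by (rule has_derivative_compose) (use F in simp)
    qed
    moreover have "(\<lambda>s. ?P (s *\<^sub>R axis 1 1) $ 1) = (*) (?P (axis 1 1) $ 1)"
      by (simp add: fun_eq_iff P.scaleR mult.commute)
    ultimately have "?P (axis 1 1) $ 1 < 0"
      "((\<lambda>s. F (?x + s *\<^sub>R axis 1 1) $ 1) has_real_derivative ?P (axis 1 1) $ 1) (at 0)"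
      by (simp_all add: has_field_derivative_def)
    then obtain d where d: "0 < d"
      "\<And>h. 0 < h \<Longrightarrow> h < d \<Longrightarrow> F ?x $ 1 < F (?x - h *\<^sub>R axis 1 1) $ 1"
      using has_real_derivative_neg_dec_left[of "\<lambda>s. F (?x + s *\<^sub>R axis 1 1) $ 1" _ 0 UNIV] by force
    obtain s where s: "0 < s" "s < d" "?x - s *\<^sub>R axis 1 1 \<in> U"
      using near[OF U(1,2) d(1)] by metis
    have "F (?x - s *\<^sub>R axis 1 1) $ 1 < 0"
      by (rule half[OF s(3) half_space4_translate[OF bdry_in_half_space s(1)]])
    with d(2)[OF s(1,2)] bd[OF U(2)] show False by simp
  qed
  ultimately have "det (matrix (\<lambda>v. tail3 (?P (bdry v)))) < 0"
    using neg0 by (auto simp: mult_less_0_iff)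
  then show ?thesis using frechet_derivative_at[OF K] by simp
qed

text \<open>With opposite signs for \<open>g\<close> and \<open>g'\<close>, the chain rule makes the
  determinant of the transition map negative in the interior. Both charts use the same outward first
  coordinate, so the induced map of the boundary inherits this sign.\<close>

lemma boundary_transition_orientation:
  fixes g g' :: "real^4 \<Rightarrow> complex \<times> complex"
  assumes g: "(D, g) \<in> local_params {z. 1 \<le> norm z}" and g': "(D', g') \<in> local_params {z. 1 \<le> norm z}"
    and y0: "bdry y0 \<in> D" "g (bdry y0) \<in> g' ` D'"
    and pos: "\<And>x. x \<in> D \<Longrightarrow> x $ 1 < 0 \<Longrightarrow>
      0 < det (matrix (frechet_derivative (\<lambda>x. real_coords (g x)) (at x)))"
    and neg: "\<And>x. x \<in> D' \<Longrightarrow> x $ 1 < 0 \<Longrightarrow>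
      det (matrix (frechet_derivative (\<lambda>x. real_coords (g' x)) (at x))) < 0"
  obtains W K where "open W" "y0 \<in> W" "\<And>k. Ck_on k W K"
    "\<And>y. y \<in> W \<Longrightarrow> bdry y \<in> D \<and> bdry (K y) \<in> D' \<and> g' (bdry (K y)) = g (bdry y)"
    "det (matrix (frechet_derivative K (at y0))) < 0"
proof -
  obtain U F where U: "open U" "bdry y0 \<in> U" "\<And>k. Ck_on k U F"
    and F: "\<And>x. x \<in> half_space4 \<Longrightarrow> x \<in> U \<Longrightarrow> x \<in> D \<and> F x \<in> D' \<and> g' (F x) = g x"
    using local_params_transition[OF g g' y0] by metis
  have half: "F x $ 1 < 0" if "x \<in> U" "x $ 1 < 0" for x
  proof -
    have x: "x \<in> D" "F x \<in> D'" "g' (F x) = g x"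
      using F[OF interior_half_space4_mem[OF that(2)] that(1)] by auto
    \<comment> \<open>Since \<open>g' (F x) = g x\<close>, the common norm differs from 1, which
      excludes the face on both sides.\<close>
    then have "F x $ 1 \<noteq> 0"
      using local_params_ball_complement_norm[OF g x(1)] local_params_ball_complement_norm[OF g' x(2)]
        that by simp
    moreover have "F x $ 1 \<le> 0" using x(2) local_paramsD(6)[OF g'] by (auto simp: half_space4_def)
    ultimately show ?thesis by simp
  qed
  have "det (matrix (frechet_derivative (\<lambda>y. tail3 (F (bdry y))) (at y0))) < 0"
  proof (rule boundary_transition_det_neg[OF U(1-3)])
    show "F (bdry y) $ 1 = 0" if "bdry y \<in> U" for y
      by (rule bdry_transition[OF g g' F that])
    show "det (matrix (frechet_derivative F (at x))) < 0" if x: "x \<in> U" "x $ 1 < 0" for x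
    proof -
      have "x \<in> D" "F x \<in> D'" using F[OF interior_half_space4_mem[OF x(2)] x(1)] by auto
      with pos x(2) neg half[OF x]
      have "0 < det (matrix (frechet_derivative (\<lambda>x. real_coords (g' x)) (at (F x)))) *
            det (matrix (frechet_derivative F (at x)))"
        "det (matrix (frechet_derivative (\<lambda>x. real_coords (g' x)) (at (F x)))) < 0"
        using transition_derivative_det[OF g g' U(1) U(3)[of 1] F x half[OF x]] by metis+
      then show ?thesis by (simp add: zero_less_mult_iff)
    qed
    show "det (matrix (frechet_derivative F (at (bdry y0)))) \<noteq> 0"
      by (rule transition_det_nonzero[OF g g' U(1) U(3)[of 1] F U(2)]) auto
  qed (use half in auto)
  then show ?thesis
  proof (rule that[of "bdry -` U" "\<lambda>y. tail3 (F (bdry y))", rotated -1])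
    show "bdry y \<in> D \<and> bdry (tail3 (F (bdry y))) \<in> D' \<and> g' (bdry (tail3 (F (bdry y)))) = g (bdry y)"
      if "y \<in> bdry -` U" for y
      using that bdry_transition[OF g g' F, where y = y] F[of "bdry y"] by simp
  qed (use U in \<open>simp_all add: open_vimage_bdry Ck_on_bdry_transition\<close>)
qed

section \<open>The blow-up near the line at infinity\<close>

lemma angle_of_eq_iff: "angle_of s = angle_of t \<longleftrightarrow> cis s = cis t"
proof -
  have "angle_of s = angle_of t \<longleftrightarrow> (\<exists>k::int. s = t + 2 * pi * of_int k)"
    by (rule angle.abs_eq_iff)
  also have "\<dots> \<longleftrightarrow> cis s = cis t"
    by (simp add: complex_eq_iff sin_cos_eq_iff[symmetric] conj_commute)
  finally show ?thesis .
qed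

lemma cis_angle_of [simp]: "cis_angle (angle_of t) = cis t"
  by (rule cis_angle.abs_eq)

lemma angle_cases: obtains t where "\<theta> = angle_of t"
proof -
  have "\<exists>t. \<theta> = angle_of t" by (rule angle.abs_induct) auto
  then show ?thesis using that by blast
qed

text \<open>Together with \<open>cis_angle_add\<close> this embeds the group of angles into the unit
  complex numbers, so identities for \<open>arg\<close> can be checked there, with no bookkeeping of
  multiples of 2 pi.\<close>

lemma cis_angle_inject: "cis_angle a = cis_angle b \<longleftrightarrow> a = b"
  by (metis angle_cases angle_of_eq_iff cis_angle_of)

lemma cis_angle_add: "cis_angle (a + b) = cis_angle a * cis_angle b"
  by (cases a rule: angle_cases; cases b rule: angle_cases) (simp add: plus_angle.abs_eq cis_mult)

lemma cis_angle_nonzero [simp]: "cis_angle a \<noteq> 0"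
  by (cases a rule: angle_cases) simp

lemma norm_cis_angle [simp]: "norm (cis_angle a) = 1"
  by (cases a rule: angle_cases) simp

lemma cis_angle_arg: "z \<noteq> 0 \<Longrightarrow> cis_angle (arg z) = sgn z"
  by (simp add: arg_def cis_Arg)

lemma arg_mult: "z \<noteq> 0 \<Longrightarrow> w \<noteq> 0 \<Longrightarrow> arg (z * w) = arg z + arg w"
  by (simp add: cis_angle_inject[symmetric] cis_angle_add cis_angle_arg sgn_mult)

lemma arg_divide: "z \<noteq> 0 \<Longrightarrow> w \<noteq> 0 \<Longrightarrow> arg (z / w) = arg z - arg w"
  using arg_mult[of "z / w" w] by simp

lemma arg_cis_angle: "arg (cis_angle a) = a"
  by (simp add: cis_angle_inject[symmetric] cis_angle_arg sgn_eq)

lemma arg_pos_mult_cis: "0 < c \<Longrightarrow> arg (of_real c * cis t) = angle_of t"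
  by (simp add: cis_angle_inject[symmetric] cis_angle_arg sgn_eq norm_mult)

lemma linf_chart1_inject: "linf_chart1 a = linf_chart1 b \<longleftrightarrow> a = b"
  by transfer simp

lemma linf_chart2_inject: "linf_chart2 a = linf_chart2 b \<longleftrightarrow> a = b"
  by transfer simp

lemma linf_chart1_eq_linf_chart2:
  "linf_chart1 (v, \<theta>) = linf_chart2 (w, \<phi>) \<longleftrightarrow> v \<noteq> 0 \<and> w = 1 / v \<and> \<phi> = \<theta> - arg v"
  by transfer simp

lemma linf_boundary_cases:
  obtains v \<theta> where "x = linf_chart1 (v, \<theta>)" | v \<theta> where "x = linf_chart2 (v, \<theta>)"
proof -
  have "(\<exists>w. x = linf_chart1 w) \<or> (\<exists>w. x = linf_chart2 w)"
    unfolding linf_chart1_def linf_chart2_def map_fun_apply id_apply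
  proof (rule linf_boundary.abs_induct)
    fix y
    show "(\<exists>w. abs_linf_boundary y = abs_linf_boundary (Inl w)) \<or>
        (\<exists>w. abs_linf_boundary y = abs_linf_boundary (Inr w))"
      by (cases y) blast+
  qed
  then show ?thesis using that by (auto simp: split_paired_Ex)
qed

lemma linf_action_chart1: "linf_action \<Theta> (linf_chart1 (v, \<theta>)) = linf_chart1 (v, \<theta> + \<Theta>)"
  by transfer simp

lemma linf_action_chart2: "linf_action \<Theta> (linf_chart2 (v, \<theta>)) = linf_chart2 (v, \<theta> + \<Theta>)"
  by transfer simp

lemma S3_to_linf_chart1: "z1 \<noteq> 0 \<Longrightarrow> S3_to_linf (z1, z2) = linf_chart1 (z2 / z1, - arg z1)"
  by (simp add: S3_to_linf_def)

text \<open>If both coordinates are nonzero, \<open>S3_to_linf\<close> is defined by the first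
  chart, and the gluing rule gives - arg z1 - arg (z2 / z1) = - arg z2. This is the agreement of the
  two formulas on the overlap.\<close>

lemma S3_to_linf_chart2: "z2 \<noteq> 0 \<Longrightarrow> S3_to_linf (z1, z2) = linf_chart2 (z1 / z2, - arg z2)"
  by (simp add: S3_to_linf_def linf_chart1_eq_linf_chart2 arg_divide)

lemma S3_to_linf_action:
  assumes "z \<in> S3"
  shows "S3_to_linf (S3_action \<Theta> z) = linf_action \<Theta> (S3_to_linf z)"
proof (cases z)
  case (Pair z1 z2)
  show ?thesis
  proof (cases "z1 = 0")
    case True
    then have "z2 \<noteq> 0" using assms Pair by (auto simp: S3_def)
    then show ?thesis
      by (simp add: Pair S3_action_def S3_to_linf_chart2 linf_action_chart2 linf_chart2_inject
          arg_mult arg_cis_angle)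
  next
    case False
    then show ?thesis
      by (simp add: Pair S3_action_def S3_to_linf_chart1 linf_action_chart1 linf_chart1_inject
          arg_mult arg_cis_angle)
  qed
qed

lemma continuous_on_cis_angle: "continuous_on UNIV cis_angle"
proof (subst continuous_on_open_vimage[OF open_UNIV], intro allI impI)
  fix B :: "complex set"
  assume "open B"
  then have "open (cis -` B)" by (intro open_vimage continuous_intros)
  moreover have "angle_of -` (cis_angle -` B) = cis -` B" by auto
  ultimately show "open (cis_angle -` B \<inter> UNIV)" by (simp add: open_angle_def)
qed

text \<open>Multiplying out the quotient makes the condition closed and leaves the angle free over u
  = 0. Conversely, each point over u = 0 is approached along the ray with its own angle.\<close>

lemma blowup_local_eq: "blowup_local = {(u, v, \<theta>). u = of_real (norm u) * cis_angle \<theta>}"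
  (is "_ = ?X")
proof -
  let ?I = "{(u, v, \<theta>). u \<noteq> 0 \<and> u / of_real (norm u) = cis_angle \<theta>} :: (complex \<times> complex \<times> angle) set"
  have X: "?X = {w. fst w = of_real (norm (fst w)) * cis_angle (snd (snd w))}" by auto
  have "closed ?X"
    unfolding X
    by (intro closed_Collect_eq continuous_intros continuous_on_compose2[OF continuous_on_cis_angle]) auto
  moreover have "?I \<subseteq> ?X" by (auto simp: field_simps)
  ultimately have "closure ?I \<subseteq> ?X" by (intro closure_minimal)
  moreover have "?X \<subseteq> closure ?I"
  proof
    fix w assume "w \<in> ?X"
    then obtain u v \<theta> where w: "w = (u, v, \<theta>)" "u = of_real (norm u) * cis_angle \<theta>" by auto
    show "w \<in> closure ?I"
    proof (cases "u = 0")
      case False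
      then have "of_real (norm u) * cis_angle \<theta> / of_real (norm u) = cis_angle \<theta>" by simp
      then have "u / of_real (norm u) = cis_angle \<theta>" unfolding w(2)[symmetric] .
      then have "w \<in> ?I" using False by (simp add: w(1))
      then show ?thesis by (rule subsetD[OF closure_subset])
    next
      case True
      \<comment> \<open>\<open>angle\<close> carries only a topology, so membership in the closure
        is tested on open sets. The curve \<open>?c\<close> has constant \<open>v\<close> and angle,
        and for positive parameters it stays in the set whose closure is taken.\<close>
      show ?thesis unfolding closure_iff_nhds_not_empty
      proof (intro allI impI)
        fix A V assume V: "V \<subseteq> A" "open V" "w \<in> V"
        let ?c = "\<lambda>s::real. (of_real s * cis_angle \<theta>, v, \<theta>)"
        have "continuous_on UNIV ?c" by (intro continuous_intros)
        then have "open (?c -` V)" using V(2) by (intro open_vimage)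
        moreover have "0 \<in> ?c -` V" using V(3) w True by simp
        ultimately obtain e where e: "0 < e" "ball 0 e \<subseteq> ?c -` V" using openE by blast
        have "e / 2 \<in> ball 0 e" using e(1) by (simp add: dist_real_def)
        then have "?c (e / 2) \<in> V" using e(2) by blast
        moreover have "?c (e / 2) \<in> ?I" using e(1) by (simp add: norm_mult)
        ultimately show "?I \<inter> A \<noteq> {}" using V(1) by blast
      qed
    qed
  qed
  ultimately show ?thesis by (simp add: blowup_local_def)
qed

section \<open>The covering of the blow-up and the radial map\<close>

definition blowup_cover :: "(complex \<times> complex \<times> real) set" where
  "blowup_cover = {(u, v, t). u = of_real (norm u) * cis t}"

lemma vimage_blowup_local: "angle_cover -` blowup_local = blowup_cover"
  by (auto simp: blowup_local_eq blowup_cover_def angle_cover_def)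

lemma blowup_cover_cases:
  assumes "w \<in> blowup_cover"
  obtains r v t where "0 \<le> r" "w = (of_real r * cis t, v, t)"
proof -
  obtain u v t where w: "w = (u, v, t)" by (cases w)
  then have "u = of_real (norm u) * cis t" using assms by (simp add: blowup_cover_def)
  then show ?thesis using that[of "norm u" t v] w by simp
qed

text \<open>For v = z2 / z1 this is |z1| / |z|, the modulus of the first coordinate after scaling z
  to the unit sphere.\<close>

definition inv_length :: "complex \<Rightarrow> real" where
  "inv_length v = inverse (sqrt (1 + v \<bullet> v))"

text \<open>On the cover u = r e^(it), so conj(u) = r e^(-it) and w = s (1 + s r) e^(-it). Writing
  conj(u) for r e^(-it) removes the modulus of u and keeps the formula smooth on the whole ambient
  space.\<close>

definition from_cover :: "complex \<times> complex \<times> real \<Rightarrow> complex \<times> complex" where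
  "from_cover = (\<lambda>(u, v, t).
     let s = of_real (inv_length v); w = s * cis (- t) + s * s * cnj u in (w, v * w))"

definition radial_inversion :: "'a::real_normed_vector \<Rightarrow> 'a" where
  "radial_inversion z = (1 / ((norm z)\<^sup>2 - norm z)) *\<^sub>R z"

definition to_blowup :: "complex \<times> complex \<Rightarrow> blowup" where
  "to_blowup z = (if norm z = 1 then At_infinity (S3_to_linf z) else Affine (radial_inversion z))"

lemma inv_length_pos: "0 < inv_length v"
  by (simp add: inv_length_def add_pos_nonneg)

lemma norm_pair_mult: "norm (w, v * w :: complex) * inv_length v = norm w"
proof -
  have "(norm w)\<^sup>2 + (norm (v * w))\<^sup>2 = (norm w)\<^sup>2 * (1 + v \<bullet> v)"
    by (simp add: norm_mult power_mult_distrib distrib_left power2_norm_eq_inner[of v, symmetric])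
  then have "norm (w, v * w) = norm w * sqrt (1 + v \<bullet> v)"
    by (simp add: norm_Pair real_sqrt_mult)
  moreover have "1 + v \<bullet> v > 0" by (simp add: add_pos_nonneg)
  ultimately show ?thesis by (simp add: inv_length_def)
qed

lemma from_cover_polar:
  "from_cover (of_real r * cis t, v, t) =
    (of_real (inv_length v * (1 + inv_length v * r)) * cis (- t),
     v * (of_real (inv_length v * (1 + inv_length v * r)) * cis (- t)))"
  by (simp add: from_cover_def Let_def algebra_simps flip: cis_cnj)

lemma norm_from_cover_polar:
  assumes "0 \<le> r"
  shows "norm (from_cover (of_real r * cis t, v, t)) = 1 + inv_length v * r"
proof -
  have "norm (from_cover (of_real r * cis t, v, t)) * inv_length v =
      inv_length v * (1 + inv_length v * r)"
    unfolding from_cover_polar norm_pair_mult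
    using inv_length_pos[of v] assms by (simp add: norm_mult add_nonneg_nonneg abs_mult flip: of_real_mult of_real_add)
  then show ?thesis using inv_length_pos[of v] by simp
qed

lemma from_cover_norm_ge: "w \<in> blowup_cover \<Longrightarrow> 1 \<le> norm (from_cover w)"
  using norm_from_cover_polar inv_length_pos
  by (elim blowup_cover_cases) (simp add: mult_nonneg_nonneg less_imp_le)

lemma norm_swap [simp]: "norm (prod.swap z) = norm z"
  by (cases z) (simp add: norm_Pair add.commute)

text \<open>With R = 1 + s r one has R^2 - R = R s r. Dividing the first coordinate s R e^(-it) by
  it leaves e^(-it) / r = 1/u, which is the affine coordinate x; for r = 0 only the direction
  survives, and it is the angle at infinity. The second chart differs by exchanging the two
  coordinates.\<close>

lemma blowup_charts_eq_to_blowup: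
  assumes "w \<in> blowup_cover"
  shows "blowup_chart1 (angle_cover w) = to_blowup (from_cover w)"
    and "blowup_chart2 (angle_cover w) = to_blowup (prod.swap (from_cover w))"
proof -
  from assms obtain r v t where r: "0 \<le> r" and w: "w = (of_real r * cis t, v, t)"
    by (rule blowup_cover_cases)
  define s where "s = inv_length v"
  have s: "0 < s" using inv_length_pos by (simp add: s_def)
  define R where "R = 1 + s * r"
  have R: "1 \<le> R" "norm (from_cover w) = R"
    using r s by (simp_all add: R_def w norm_from_cover_polar s_def)
  define c where "c = of_real (s * R) * cis (- t)"
  have fc: "from_cover w = (c, v * c)"
    by (simp only: w from_cover_polar s_def R_def c_def)
  have sR: "0 < s * R" using s R by simp
  have c0: "c \<noteq> 0" using s R(1) by (simp add: c_def)
  have n: "norm (c, v * c) = R" "norm (v * c, c) = R"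
    using R(2) norm_swap[of "(c, v * c)"] by (simp_all add: fc)
  define \<theta> where "\<theta> = angle_of t"
  have ac: "angle_cover w = (of_real r * cis t, v, \<theta>)" by (simp add: w angle_cover_def \<theta>_def)
  have "blowup_chart1 (angle_cover w) = to_blowup (c, v * c) \<and>
    blowup_chart2 (angle_cover w) = to_blowup (v * c, c)"
  proof (cases "r = 0")
    case True
    then have R: "R = 1" by (simp add: R_def)
    have "- arg c = \<theta>"
      unfolding c_def \<theta>_def arg_pos_mult_cis[OF sR] by (simp add: uminus_angle.abs_eq)
    then show ?thesis
      using c0 by (simp add: to_blowup_def n R blowup_chart1_def blowup_chart2_def ac True
          S3_to_linf_chart1 S3_to_linf_chart2)
  next
    case False
    then have r: "0 < r" using r by simp
    then have R1: "1 < R" using s by (simp add: R_def)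
    have e: "R\<^sup>2 - R = R * s * r" by (simp add: R_def power2_eq_square algebra_simps)
    have "of_real (1 / (R\<^sup>2 - R)) * c = of_real (1 / r) * cis (- t)"
      unfolding e c_def mult.assoc[symmetric] of_real_mult[symmetric] using R1 s r by simp
    also have "\<dots> = 1 / (of_real r * cis t)" by (simp add: divide_inverse)
    finally have "(1 / (R\<^sup>2 - R)) *\<^sub>R c = 1 / (of_real r * cis t)"
      by (simp add: scaleR_conv_of_real)
    moreover from this have "(1 / (R\<^sup>2 - R)) *\<^sub>R (v * c) = v / (of_real r * cis t)"
      by (metis mult_scaleR_right times_divide_eq_right mult.right_neutral)
    ultimately show ?thesis
      using R1 r by (simp add: to_blowup_def n blowup_chart1_def blowup_chart2_def ac radial_inversion_def)
  qed
  then show "blowup_chart1 (angle_cover w) = to_blowup (from_cover w)"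
    "blowup_chart2 (angle_cover w) = to_blowup (prod.swap (from_cover w))" by (auto simp: fc)
qed

lemma Ck_on_from_cover: "Ck_on k UNIV from_cover"
proof -
  define a where "a w = complex_of_real (inv_length (fst (snd w)))" for w :: "complex \<times> complex \<times> real"
  have "Ck_on k UNIV a"
    unfolding a_def[abs_def] inv_length_def
    by (intro Ck_on_of_real Ck_on_inverse_sqrt Ck_on_add Ck_on_inner Ck_on_fst Ck_on_snd Ck_on_ident
        Ck_on_const open_UNIV) (simp add: add_pos_nonneg)
  then have "Ck_on k UNIV (\<lambda>w. a w * cis (- snd (snd w)) + a w * a w * cnj (fst w))"
    by (intro Ck_on_add Ck_on_mult Ck_on_cis Ck_on_minus Ck_on_linear_compose[OF _ bounded_linear_cnj]
        Ck_on_fst Ck_on_snd Ck_on_ident open_UNIV)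
  then have "Ck_on k UNIV (\<lambda>w. (a w * cis (- snd (snd w)) + a w * a w * cnj (fst w),
      fst (snd w) * (a w * cis (- snd (snd w)) + a w * a w * cnj (fst w))))"
    by (intro Ck_on_Pair Ck_on_mult Ck_on_fst Ck_on_snd Ck_on_ident open_UNIV)
  then show ?thesis by (simp add: from_cover_def Let_def case_prod_beta' a_def)
qed

text \<open>Solving \<open>from_cover\<close> for its arguments gives u = (|z|^2 - |z|) / z1 and v =
  z2 / z1, while t is a branch of minus the argument of z1. Only the branch is local: taking the
  logarithm of z1 / c, with c the first coordinate of the base point, makes it smooth near that
  point and gives it the value t0 there.\<close>

lemma from_cover_local_inverse:
  assumes "w0 \<in> blowup_cover"
  shows "\<exists>S \<Phi>. open S \<and> from_cover w0 \<in> S \<and> (\<forall>k. Ck_on k S \<Phi>) \<and>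
    (\<forall>z\<in>{z. 1 \<le> norm z} \<inter> S. \<Phi> z \<in> blowup_cover \<and> from_cover (\<Phi> z) = z) \<and> \<Phi> (from_cover w0) = w0"
proof -
  from assms obtain r0 v0 t0 where r0: "0 \<le> r0" and w0: "w0 = (of_real r0 * cis t0, v0, t0)"
    by (rule blowup_cover_cases)
  define s0 where "s0 = inv_length v0"
  define R0 where "R0 = 1 + s0 * r0"
  have s0: "0 < s0" using inv_length_pos by (simp add: s0_def)
  have R0: "1 \<le> R0" "norm (from_cover w0) = R0"
    using r0 s0 by (simp_all add: R0_def w0 norm_from_cover_polar s0_def)
  define c where "c = of_real (s0 * R0) * cis (- t0)"
  have fc0: "from_cover w0 = (c, v0 * c)"
    by (simp only: w0 from_cover_polar s0_def R0_def c_def)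
  have c0: "c \<noteq> 0" using s0 R0(1) by (simp add: c_def)
  have sgn_c: "sgn c = cis (- t0)"
    using s0 R0(1) by (simp add: c_def sgn_mult sgn_of_real)
  \<comment> \<open>This is |z|^2 - |z|, written with the inner product and the inverse square root
    so that the smoothness rules apply to it.\<close>
  define q where "q z = z \<bullet> z - (z \<bullet> z) * inverse (sqrt (z \<bullet> z))" for z :: "complex \<times> complex"
  have q: "q z = (norm z)\<^sup>2 - norm z" for z
    unfolding q_def norm_eq_sqrt_inner[symmetric] power2_norm_eq_inner[symmetric]
    by (cases "z = 0") (simp_all add: power2_eq_square)
  define S where "S = {z::complex \<times> complex. fst z / c \<notin> \<real>\<^sub>\<le>\<^sub>0}"
  define \<Phi> where "\<Phi> z = (of_real (q z) / fst z, snd z / fst z, t0 - Im (Ln (fst z / c)))" for z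
  have S0: "fst z \<noteq> 0" if "z \<in> S" for z using that by (auto simp: S_def)
  have "continuous_on UNIV (\<lambda>z::complex \<times> complex. fst z / c)" using c0 by (intro continuous_intros) auto
  then have "open ((\<lambda>z::complex \<times> complex. fst z / c) -` (- \<real>\<^sub>\<le>\<^sub>0))" by (intro open_vimage) auto
  moreover have "(\<lambda>z::complex \<times> complex. fst z / c) -` (- \<real>\<^sub>\<le>\<^sub>0) = S" by (auto simp: S_def)
  ultimately have S: "open S" by simp
  have S1: "0 < z \<bullet> z" "fst z / c \<notin> \<real>\<^sub>\<le>\<^sub>0" if "z \<in> S" for z
    using S0[OF that] that by (auto simp: S_def)
  have Ck: "Ck_on k S \<Phi>" for k
    unfolding \<Phi>_def[abs_def] q_def
    by (intro Ck_on_Pair Ck_on_divide Ck_on_of_real Ck_on_diff Ck_on_mult Ck_on_inner Ck_on_inverse_sqrt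
        Ck_on_linear_compose[OF _ bounded_linear_Im] Ck_on_Ln Ck_on_fst Ck_on_snd Ck_on_ident Ck_on_const S)
      (simp_all only: S0 S1 c0 not_False_eq_True)
  have inv: "\<Phi> z \<in> blowup_cover \<and> from_cover (\<Phi> z) = z" if z: "1 \<le> norm z" "z \<in> S" for z
  proof -
    define R where "R = norm z"
    define z1 where "z1 = fst z"
    define v where "v = snd z / z1"
    define t where "t = t0 - Im (Ln (z1 / c))"
    have z1: "z1 \<noteq> 0" using S0[OF z(2)] by (simp add: z1_def)
    have z_eq: "z = (z1, v * z1)" using z1 by (simp add: v_def prod_eq_iff z1_def)
    define \<rho> where "\<rho> = norm z1"
    have \<rho>: "0 < \<rho>" using z1 by (simp add: \<rho>_def)
    have "cis (Im (Ln (z1 / c))) = sgn (z1 / c)"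
      using z1 c0 by (simp add: Arg_eq_Im_Ln[symmetric] cis_Arg)
    then have "cis (Im (Ln (z1 / c))) = sgn z1 / cis (- t0)"
      using sgn_c by (simp add: sgn_divide)
    moreover have "cis (- t) = cis (Im (Ln (z1 / c))) * cis (- t0)"
      by (simp add: t_def cis_mult)
    ultimately have "cis (- t) = sgn z1 / cis (- t0) * cis (- t0)" by (simp only:)
    then have "cis (- t) = sgn z1"
      by (simp only: times_divide_eq_left nonzero_mult_div_cancel_right cis_neq_zero not_False_eq_True)
    then have z1_polar: "z1 = of_real \<rho> * cis (- t)"
      using z1 by (simp add: \<rho>_def sgn_eq)
    define r where "r = (R\<^sup>2 - R) / \<rho>"
    have "R * 1 \<le> R * R" using z(1) by (intro mult_left_mono) (auto simp: R_def)
    then have r: "0 \<le> r" using \<rho> by (simp add: r_def power2_eq_square)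
    have "of_real (q z) / z1 = of_real r * cis t"
      unfolding z1_polar r_def q R_def[symmetric] by (simp add: divide_inverse)
    then have \<Phi>: "\<Phi> z = (of_real r * cis t, v, t)"
      by (simp add: \<Phi>_def z1_def[symmetric] v_def t_def)
    have "norm z * inv_length v = \<rho>"
      unfolding \<rho>_def by (subst z_eq) (rule norm_pair_mult)
    then have sR: "inv_length v * R = \<rho>" by (simp add: R_def mult.commute)
    \<comment> \<open>With s = \<rho> / R and r = (R^2 - R) / \<rho>, the product s r is R - 1, so
      the left side is s R.\<close>
    then have s: "inv_length v * (1 + inv_length v * r) = \<rho>"
      using \<rho> inv_length_pos[of v] z(1)
      by (simp add: r_def R_def[symmetric] sR[symmetric] power2_eq_square field_simps)
    have "from_cover (\<Phi> z) = (z1, v * z1)"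
      by (simp only: \<Phi> from_cover_polar s z1_polar[symmetric])
    then have "from_cover (\<Phi> z) = z" by (simp only: z_eq[symmetric])
    moreover have "\<Phi> z \<in> blowup_cover"
      using r by (simp add: \<Phi> blowup_cover_def norm_mult)
    ultimately show ?thesis by simp
  qed
  have "\<Phi> (from_cover w0) = w0"
  proof -
    have "q (from_cover w0) = R0 * s0 * r0"
      unfolding q R0(2) by (simp add: R0_def power2_eq_square algebra_simps)
    then have "of_real (q (from_cover w0)) / c = of_real r0 * cis t0"
    proof -
      have "of_real (R0 * s0 * r0) / (of_real (s0 * R0) * cis (- t0)) =
          of_real (R0 * s0 * r0 / (s0 * R0)) * (1 / cis (- t0))" by simp
      also have "R0 * s0 * r0 / (s0 * R0) = r0" using s0 R0(1) by simp
      also have "1 / cis (- t0) = cis t0" by (simp add: divide_inverse)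
      finally show ?thesis by (simp only: c_def \<open>q (from_cover w0) = R0 * s0 * r0\<close>)
    qed
    moreover have "fst (from_cover w0) = c" "snd (from_cover w0) = v0 * c" by (simp_all add: fc0)
    ultimately have "\<Phi> (from_cover w0) = (of_real r0 * cis t0, v0, t0)"
      using c0 by (simp add: \<Phi>_def)
    then show ?thesis by (simp only: w0)
  qed
  moreover have "from_cover w0 \<in> S" using c0 by (simp add: S_def fc0)
  ultimately show ?thesis using S Ck inv by (intro exI[of _ S] exI[of _ \<Phi>]) auto
qed

text \<open>\<open>\<Psi>\<close> need not be injective on \<open>X\<close>:
  \<open>from_cover\<close> has period 2 pi in its last argument. Injectivity is therefore required
  only on the chart, and smooth local inverses through each given preimage replace a global
  one.\<close>

lemma local_params_compose:
  fixes X :: "'e::euclidean_space set" and Y :: "'f::euclidean_space set"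
  assumes g: "(D, g) \<in> local_params X"
    and \<Psi>: "\<And>k. Ck_on k UNIV \<Psi>" "\<Psi> ` X \<subseteq> Y" "inj_on (\<lambda>x. \<Psi> (g x)) D"
    and local_inverse: "\<And>w. w \<in> X \<Longrightarrow> \<exists>S \<Phi>. open S \<and> \<Psi> w \<in> S \<and> (\<forall>k. Ck_on k S \<Phi>) \<and>
      (\<forall>z\<in>Y \<inter> S. \<Phi> z \<in> X \<and> \<Psi> (\<Phi> z) = z) \<and> \<Phi> (\<Psi> w) = w"
  shows "(D, \<lambda>x. \<Psi> (g x)) \<in> local_params Y"
proof -
  note P = local_paramsD[OF g]
  let ?g = "\<lambda>x. \<Psi> (g x)"
  let ?h = "the_inv_into D ?g"
  have loc: "\<exists>N. openin (top_of_set Y) N \<and> z0 \<in> N \<and> N \<subseteq> ?g ` D \<and> smooth_on N ?h"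
    if z0: "z0 \<in> ?g ` D" for z0
  proof -
    obtain x0 where x0: "x0 \<in> D" "z0 = \<Psi> (g x0)" using z0 by blast
    then have "g x0 \<in> X" using P(7) by blast
    from local_inverse[OF this] obtain S \<Phi> where S: "open S" "z0 \<in> S" "\<forall>k. Ck_on k S \<Phi>"
      "\<forall>z\<in>Y \<inter> S. \<Phi> z \<in> X \<and> \<Psi> (\<Phi> z) = z" "\<Phi> z0 = g x0"
      unfolding x0(2)[symmetric] by (elim exE conjE) (rule that)
    obtain V where V: "open V" "g ` D = X \<inter> V" using P(2) by (auto simp: openin_open)
    have o: "open (S \<inter> \<Phi> -` V)"
      using Ck_on_imp_continuous_on[OF S(3)[rule_format, of 0]] S(1) V(1) by (simp add: continuous_open_preimage)
    \<comment> \<open>The local inverse must land in the image of this chart and not merely in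
      \<open>X\<close>; \<open>V\<close> cuts that image out of \<open>X\<close>. On such points the
      inverse of the composite is the inverse of \<open>g\<close> after
      \<open>\<Phi>\<close>.\<close>
    define N where "N = Y \<inter> (S \<inter> \<Phi> -` V)"
    have N: "\<Phi> z \<in> g ` D" "\<Psi> (\<Phi> z) = z" if "z \<in> N" for z
      using that S(4) V(2) by (auto simp: N_def)
    have h: "z \<in> ?g ` D" "?h z = the_inv_into D g (\<Phi> z)" if z: "z \<in> N" for z
    proof -
      obtain x where x: "x \<in> D" "g x = \<Phi> z" using N(1)[OF z] by (metis imageE)
      then have "?g x = z" using N(2)[OF z] by simp
      then show "z \<in> ?g ` D" using x(1) by blast
      show "?h z = the_inv_into D g (\<Phi> z)"
        using the_inv_into_f_f[OF \<Psi>(3) x(1)] the_inv_into_f_f[OF P(3) x(1)] x(2) \<open>?g x = z\<close> by simp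
    qed
    have "smooth_on N \<Phi>"
      by (rule smooth_on_if_Ck[OF S(1)]) (use S(3) in \<open>auto simp: N_def\<close>)
    then have "smooth_on N (\<lambda>z. the_inv_into D g (\<Phi> z))"
      by (rule smooth_on_compose[OF _ P(5)]) (use N(1) in blast)
    then have "smooth_on N ?h" by (rule smooth_on_cong) (simp add: h(2))
    moreover have "openin (top_of_set Y) N" using o by (auto simp: N_def openin_open)
    moreover have "z0 \<in> N"
      using x0 S(2,5) V(2) \<Psi>(2) P(7) by (auto simp: N_def)
    ultimately show ?thesis using h(1) by blast
  qed
  have op: "openin (top_of_set Y) (?g ` D)"
    using loc by (subst openin_subopen) meson
  have "smooth_on (?g ` D) ?h"
  proof (rule smooth_on_locally)
    fix z0 assume "z0 \<in> ?g ` D"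
    from loc[OF this] obtain N where N: "openin (top_of_set Y) N" "z0 \<in> N" "N \<subseteq> ?g ` D" "smooth_on N ?h"
      by (elim exE conjE) (rule that)
    have "openin (top_of_set (?g ` D)) N"
      by (rule openin_subset_trans[OF N(1,3) openin_imp_subset[OF op]])
    with N show "\<exists>B. openin (top_of_set (?g ` D)) B \<and> z0 \<in> B \<and> smooth_on B ?h"
      by (intro exI[of _ N] conjI)
  qed
  moreover have "smooth_on D ?g"
    by (rule smooth_on_compose[OF P(4) smooth_on_if_Ck[OF open_UNIV \<Psi>(1)]]) auto
  ultimately show ?thesis using P(1) op \<Psi>(3) by (simp add: local_params_def)
qed

section \<open>Jacobian and injectivity of the radial inversion\<close>

lemma less_power2_if_greater_one: "1 < r \<Longrightarrow> 0 < r\<^sup>2 - (r::real)"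
  using mult_strict_left_mono[of 1 r r] by (simp add: power2_eq_square)

lemma radial_inversion_has_derivative:
  fixes z :: "'a::real_inner"
  assumes "1 < norm z"
  defines "q \<equiv> (norm z)\<^sup>2 - norm z"
  shows "(radial_inversion has_derivative
    (\<lambda>h. (1 / q) *\<^sub>R h + (- (2 * norm z - 1) / (norm z * q\<^sup>2) * (z \<bullet> h)) *\<^sub>R z)) (at z)"
proof -
  have q: "0 < q" using less_power2_if_greater_one[OF assms(1)] by (simp add: q_def)
  have z: "z \<noteq> 0" "0 < norm z" using assms(1) by auto
  have n: "(norm has_derivative (\<lambda>h. (z \<bullet> h) / norm z)) (at z)"
    using has_derivative_norm[OF z(1)]
    by (simp add: sgn_div_norm inner_commute divide_inverse mult.commute)
  have "((\<lambda>z. (norm z)\<^sup>2 - norm z) has_derivative (\<lambda>h. (2 * norm z - 1) / norm z * (z \<bullet> h))) (at z)"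
    using z by (auto intro!: derivative_eq_intros n simp: field_simps)
  then have "((\<lambda>z. inverse ((norm z)\<^sup>2 - norm z)) has_derivative
      (\<lambda>h. - (inverse q * ((2 * norm z - 1) / norm z * (z \<bullet> h)) * inverse q))) (at z)"
    using q unfolding q_def by (intro Deriv.has_derivative_inverse) auto
  then have "(radial_inversion has_derivative (\<lambda>h. inverse q *\<^sub>R h +
      (- (inverse q * ((2 * norm z - 1) / norm z * (z \<bullet> h)) * inverse q)) *\<^sub>R z)) (at z)"
    unfolding radial_inversion_def[abs_def] divide_inverse mult_1 q_def
    by (intro has_derivative_scaleR has_derivative_ident)
  moreover have "- (inverse q * (a / norm z * b) * inverse q) = - a / (norm z * q\<^sup>2) * b" for a b :: real
    by (simp add: divide_inverse power2_eq_square)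
  ultimately show ?thesis by (simp only: inverse_eq_divide)
qed

text \<open>The three directions orthogonal to z are scaled by 1/q > 0. The radial one is scaled by
  the derivative of R -> 1 / (R - 1), namely -1 / (R - 1)^2 = - R^2 / q^2, the only negative
  eigenvalue.\<close>

lemma radial_inversion_derivative_det_neg:
  fixes z :: "real^4"
  assumes "1 < norm z"
  shows "radial_inversion differentiable (at z)"
    "det (matrix (frechet_derivative radial_inversion (at z))) < 0"
proof -
  define q where "q = (norm z)\<^sup>2 - norm z"
  define b where "b = - (2 * norm z - 1) / (norm z * q\<^sup>2)"
  have q: "0 < q" using less_power2_if_greater_one[OF assms(1)] by (simp add: q_def)
  have z: "z \<noteq> 0" using assms by auto
  let ?L = "\<lambda>h. (1 / q) *\<^sub>R h + (b * (z \<bullet> h)) *\<^sub>R z"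
  have D: "(radial_inversion has_derivative ?L) (at z)"
    using radial_inversion_has_derivative[OF assms] unfolding q_def b_def .
  then show "radial_inversion differentiable (at z)" by (auto simp: differentiable_def)
  have "det (matrix ?L) = (1 / q) ^ 3 * (1 / q + b * (z \<bullet> z))"
    by (rule det_rank_one_update_4)
      (simp add: matrix_def inner_axis, simp add: axis_def)
  moreover have "1 / q + b * (z \<bullet> z) = - (norm z)\<^sup>2 / q\<^sup>2"
  proof -
    have "norm z * q \<noteq> 0" using q assms by auto
    then have "1 / q + b * (z \<bullet> z) = (q - (2 * norm z - 1) * norm z) / q\<^sup>2"
      unfolding b_def dot_square_norm by (simp add: field_simps power2_eq_square)
    then show ?thesis by (simp add: q_def algebra_simps power2_eq_square)
  qed
  moreover have "0 < (1 / q) ^ 3" "- (norm z)\<^sup>2 / q\<^sup>2 < 0"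
    using q z by (auto simp: divide_less_0_iff)
  ultimately have "det (matrix ?L) < 0" by (simp only: mult_pos_neg)
  then show "det (matrix (frechet_derivative radial_inversion (at z))) < 0"
    by (simp only: frechet_derivative_at[OF D])
qed

lemma real_coords_radial_inversion: "real_coords (radial_inversion z) = radial_inversion (real_coords z)"
  using bounded_linear_real_coords[THEN bounded_linear.linear]
  by (simp add: radial_inversion_def linear_cmul)

text \<open>The norm of the image is 1 / (R - 1), which determines R and hence the scaling
  factor.\<close>

lemma radial_inversion_inject:
  assumes "1 < norm z" "1 < norm z'" "radial_inversion z = radial_inversion z'"
  shows "z = z'"
proof -
  have n: "norm (radial_inversion x) = 1 / (norm x - 1)" if "1 < norm x" for x :: 'a
  proof -
    have e: "(norm x)\<^sup>2 - norm x = norm x * (norm x - 1)" by (simp add: power2_eq_square algebra_simps)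
    have "x \<noteq> 0" using that by auto
    then show ?thesis using that unfolding radial_inversion_def norm_scaleR e by (simp add: abs_mult)
  qed
  have "norm z = norm z'" using n[OF assms(1)] n[OF assms(2)] assms by (simp add: field_simps)
  moreover have "(norm z')\<^sup>2 - norm z' \<noteq> 0" using less_power2_if_greater_one[OF assms(2)] by simp
  ultimately show ?thesis using assms(3) by (simp add: radial_inversion_def)
qed

section \<open>Bijectivity on the sphere and injectivity of the extension\<close>

lemma S3_eq: "S3 = {z. norm z = 1}"
  by (auto simp: S3_def norm_Pair)

lemma from_cover_S3:
  assumes "norm (z1, z2) = 1" "z1 \<noteq> 0"
  shows "(z1, z2) = from_cover (0, z2 / z1, - Arg z1)"
proof -
  have "norm z1 = inv_length (z2 / z1)"
    using norm_pair_mult[of z1 "z2 / z1"] assms by simp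
  moreover have "of_real (norm z1) * cis (Arg z1) = z1"
    using assms(2) by (simp add: cis_Arg sgn_eq)
  ultimately show ?thesis using assms(2) by (simp add: from_cover_def Let_def)
qed

lemma from_cover_cis_cong: "cis s = cis t \<Longrightarrow> from_cover (u, v, s) = from_cover (u, v, t)"
  by (simp add: from_cover_def Let_def flip: cis_inverse)

text \<open>On the unit sphere v = z2 / z1 fixes |z1|, and the angle fixes its direction: by
  \<open>from_cover_S3\<close> the point is the value of \<open>from_cover\<close> at u = 0. Points
  with z1 = 0 are exactly those outside the first chart, and they are handled by the same argument
  with coordinates exchanged.\<close>

lemma S3_to_linf_inject:
  assumes "norm z = 1" "norm w = 1" "S3_to_linf z = S3_to_linf w"
  shows "z = w"
proof -
  obtain z1 z2 w1 w2 where zw: "z = (z1, z2)" "w = (w1, w2)" by (cases z, cases w)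
  have eq: "(x1, x2) = (y1, y2)"
    if "norm (x1, x2) = 1" "norm (y1, y2) = 1" "x1 \<noteq> 0" "y1 \<noteq> 0" "x2 / x1 = y2 / y1" "- arg x1 = - arg y1"
    for x1 x2 y1 y2 :: complex
  proof -
    have "cis (Arg x1) = cis (Arg y1)"
      using that(6) by (simp add: arg_def angle_of_eq_iff)
    then have "cis (- Arg x1) = cis (- Arg y1)" by (simp flip: cis_inverse)
    then show ?thesis
      using from_cover_S3[OF that(1,3)] from_cover_S3[OF that(2,4)] that(5) from_cover_cis_cong by metis
  qed
  show ?thesis
  proof (cases "z1 = 0")
    case True
    then have "z2 \<noteq> 0" using assms(1) zw by auto
    with True assms(3) have "w1 = 0"
      by (auto simp: zw S3_to_linf_def linf_chart1_eq_linf_chart2 dest: sym[of "linf_chart2 _"] split: if_splits)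
    then have "w2 \<noteq> 0" using assms(2) zw by auto
    then show ?thesis
      using eq[of z2 z1 w2 w1] assms \<open>z2 \<noteq> 0\<close>
      by (simp add: zw S3_to_linf_chart2 linf_chart2_inject norm_Pair add.commute)
  next
    case False
    with assms(3) have "w1 \<noteq> 0"
      by (auto simp: zw S3_to_linf_def linf_chart1_eq_linf_chart2 split: if_splits)
    then show ?thesis
      using eq[of z1 z2 w1 w2] assms False by (simp add: zw S3_to_linf_chart1 linf_chart1_inject)
  qed
qed

lemma S3_to_linf_surj: "\<exists>z. norm z = 1 \<and> S3_to_linf z = x"
proof -
  have *: "\<exists>z. norm z = 1 \<and> S3_to_linf z = linf_chart1 (v, \<theta>)"
    "\<exists>z. norm z = 1 \<and> S3_to_linf z = linf_chart2 (v, \<theta>)" for v \<theta>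
  proof -
    obtain t where t: "\<theta> = angle_of t" by (rule angle_cases)
    let ?w = "(0, v, t)"
    have w: "?w \<in> blowup_cover" by (simp add: blowup_cover_def)
    have "norm (from_cover ?w) = 1" using norm_from_cover_polar[of 0 t v] by simp
    moreover have "At_infinity (linf_chart1 (v, \<theta>)) = to_blowup (from_cover ?w)"
      "At_infinity (linf_chart2 (v, \<theta>)) = to_blowup (prod.swap (from_cover ?w))"
      unfolding blowup_charts_eq_to_blowup[OF w, symmetric]
      by (simp_all add: blowup_chart1_def blowup_chart2_def angle_cover_def t)
    ultimately show "\<exists>z. norm z = 1 \<and> S3_to_linf z = linf_chart1 (v, \<theta>)"
      "\<exists>z. norm z = 1 \<and> S3_to_linf z = linf_chart2 (v, \<theta>)"
      by (metis to_blowup_def blowup.inject(2) norm_swap)+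
  qed
  show ?thesis by (cases x rule: linf_boundary_cases) (use * in auto)
qed

lemma to_blowup_S3: "norm z = 1 \<Longrightarrow> to_blowup z = At_infinity (S3_to_linf z)"
  by (simp add: to_blowup_def)

lemma to_blowup_inject:
  assumes "1 \<le> norm z" "1 \<le> norm w" "to_blowup z = to_blowup w"
  shows "z = w"
  using assms S3_to_linf_inject[of z w] radial_inversion_inject[of z w]
  by (auto simp: to_blowup_def split: if_splits)

text \<open>This transports the smooth structure of the blow-up near infinity to the ball
  complement: the parameter domain is kept, and \<open>to_blowup\<close> links the two
  parametrizations.\<close>

lemma blowup_chart_local_params:
  assumes g: "(D, g) \<in> local_params blowup_cover" and inj: "inj_on (angle_cover \<circ> g) D"
    and \<kappa>: "\<kappa> \<in> {blowup_chart1, blowup_chart2}"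
  obtains g1 where "(D, g1) \<in> local_params {z. 1 \<le> norm z}"
    "\<forall>x\<in>D. \<kappa> (angle_cover (g x)) = to_blowup (g1 x)"
proof -
  \<comment> \<open>The identity for the first chart and the exchange of coordinates for the second;
    both are linear isometric involutions, so one argument serves both charts.\<close>
  obtain \<tau> :: "complex \<times> complex \<Rightarrow> complex \<times> complex" where \<tau>: "bounded_linear \<tau>" "\<And>z. \<tau> (\<tau> z) = z" "\<And>z. norm (\<tau> z) = norm z"
    and \<kappa>_eq: "\<And>w. w \<in> blowup_cover \<Longrightarrow> \<kappa> (angle_cover w) = to_blowup (\<tau> (from_cover w))"
  proof -
    have "bounded_linear (prod.swap :: complex \<times> complex \<Rightarrow> _)"
      unfolding prod.swap_def by (intro bounded_linear_Pair bounded_linear_snd bounded_linear_fst)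
    then show ?thesis
      using \<kappa> that[of "\<lambda>z. z"] that[of prod.swap] blowup_charts_eq_to_blowup bounded_linear_ident by auto
  qed
  have gD: "g x \<in> blowup_cover" if "x \<in> D" for x using local_paramsD(7)[OF g] that by blast
  \<comment> \<open>This lets the assumed injectivity of the chart modulo the period pass to its
    composite with \<open>from_cover\<close>. Away from u = 0 the angle is recovered as the phase of
    u, since \<open>\<kappa>\<close> forgets it there.\<close>
  have \<kappa>_inj: "inj_on \<kappa> (angle_cover ` blowup_cover)"
  proof (rule inj_onI)
    fix a b
    assume "a \<in> angle_cover ` blowup_cover" "b \<in> angle_cover ` blowup_cover" and eq: "\<kappa> a = \<kappa> b"
    then have ab: "a \<in> blowup_local" "b \<in> blowup_local" by (auto simp flip: vimage_blowup_local)
    obtain u v \<theta> u' v' \<theta>' where ab_eq: "a = (u, v, \<theta>)" "b = (u', v', \<theta>')" by (cases a, cases b)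
    show "a = b"
    proof (cases "u = 0 \<or> u' = 0")
      case True
      then show ?thesis
        using eq \<kappa> ab_eq
        by (auto simp: blowup_chart1_def blowup_chart2_def linf_chart1_inject linf_chart2_inject split: if_splits)
    next
      case False
      then have uv: "u = u'" "v = v'"
        using eq \<kappa> ab_eq by (auto simp: blowup_chart1_def blowup_chart2_def)
      have "of_real (norm u) * cis_angle \<theta> = u" "of_real (norm u) * cis_angle \<theta>' = u"
        using ab by (simp_all add: ab_eq blowup_local_eq uv)
      then have "of_real (norm u) * cis_angle \<theta> = of_real (norm u) * cis_angle \<theta>'" by (simp only:)
      then have "cis_angle \<theta> = cis_angle \<theta>'" using False by simp
      then show ?thesis using uv ab_eq by (simp add: cis_angle_inject)
    qed
  qed
  have "(D, \<lambda>x. (\<tau> \<circ> from_cover) (g x)) \<in> local_params {z. 1 \<le> norm z}"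
  proof (rule local_params_compose[OF g])
    show "Ck_on k UNIV (\<tau> \<circ> from_cover)" for k
      unfolding comp_def by (intro Ck_on_linear_compose[OF _ \<tau>(1)] Ck_on_from_cover open_UNIV)
    show "(\<tau> \<circ> from_cover) ` blowup_cover \<subseteq> {z. 1 \<le> norm z}"
      by (intro image_subsetI) (simp add: from_cover_norm_ge \<tau>(3))
    show "inj_on (\<lambda>x. (\<tau> \<circ> from_cover) (g x)) D"
    proof (rule inj_onI)
      fix x y assume xy: "x \<in> D" "y \<in> D" "(\<tau> \<circ> from_cover) (g x) = (\<tau> \<circ> from_cover) (g y)"
      then have "\<kappa> (angle_cover (g x)) = \<kappa> (angle_cover (g y))" using \<kappa>_eq gD by simp
      then have "angle_cover (g x) = angle_cover (g y)"
        by (rule inj_onD[OF \<kappa>_inj]) (use gD xy in auto)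
      then show "x = y" by (intro inj_onD[OF inj _ xy(1,2)]) simp
    qed
    fix w assume "w \<in> blowup_cover"
    from from_cover_local_inverse[OF this] obtain S \<Phi> where S: "open S" "from_cover w \<in> S"
      "\<forall>k. Ck_on k S \<Phi>" "\<forall>z\<in>{z. 1 \<le> norm z} \<inter> S. \<Phi> z \<in> blowup_cover \<and> from_cover (\<Phi> z) = z"
      "\<Phi> (from_cover w) = w"
      by (elim exE conjE) (rule that)
    have o: "open (\<tau> -` S)" by (rule open_vimage[OF S(1) linear_continuous_on[OF \<tau>(1)]])
    have "Ck_on k (\<tau> -` S) (\<lambda>z. \<Phi> (\<tau> z))" for k
      by (rule Ck_on_compose[OF o Ck_on_linear[OF \<tau>(1)] S(3)[rule_format]]) auto
    moreover have "\<Phi> (\<tau> z) \<in> blowup_cover \<and> (\<tau> \<circ> from_cover) (\<Phi> (\<tau> z)) = z"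
      if "z \<in> {z. 1 \<le> norm z} \<inter> \<tau> -` S" for z
    proof -
      have "\<tau> z \<in> {z. 1 \<le> norm z} \<inter> S" using that \<tau>(3) by simp
      from S(4)[rule_format, OF this] show ?thesis by (simp add: \<tau>(2))
    qed
    ultimately show "\<exists>S \<Phi>. open S \<and> (\<tau> \<circ> from_cover) w \<in> S \<and> (\<forall>k. Ck_on k S \<Phi>) \<and>
        (\<forall>z\<in>{z. 1 \<le> norm z} \<inter> S. \<Phi> z \<in> blowup_cover \<and> (\<tau> \<circ> from_cover) (\<Phi> z) = z) \<and>
        \<Phi> ((\<tau> \<circ> from_cover) w) = w"
      using S(2,5) o \<tau>(2) by (intro exI[of _ "\<tau> -` S"] exI[of _ "\<lambda>z. \<Phi> (\<tau> z)"]) auto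
  qed
  moreover have "\<forall>x\<in>D. \<kappa> (angle_cover (g x)) = to_blowup ((\<tau> \<circ> from_cover) (g x))"
    using \<kappa>_eq[OF gD] by simp
  ultimately show ?thesis by (rule that)
qed

text \<open>An affine parametrization has target \<open>UNIV\<close>, all of whose points are
  interior, so its domain cannot meet the face. Only the charts at infinity remain.\<close>

lemma blowup_atlas_cases:
  assumes "(D, p) \<in> blowup_atlas" "bdry -` D \<noteq> {}"
  obtains g where "(D, g) \<in> local_params {z. 1 \<le> norm z}" "\<forall>x\<in>D. p x = to_blowup (g x)"
proof -
  obtain y where "bdry y \<in> D" using assms(2) by blast
  then have no_affine: "(D, g) \<notin> local_params UNIV" for g :: "real^4 \<Rightarrow> complex \<times> complex"
    using local_params_boundary_notin_interior[of D g UNIV "bdry y"] by auto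
  from assms(1) obtain g \<kappa> where g: "p = \<kappa> \<circ> angle_cover \<circ> g" "\<kappa> \<in> {blowup_chart1, blowup_chart2}"
    "(D, g) \<in> local_params blowup_cover" "inj_on (angle_cover \<circ> g) D"
    unfolding blowup_atlas_def vimage_blowup_local using no_affine by blast
  obtain g1 where "(D, g1) \<in> local_params {z. 1 \<le> norm z}"
    "\<forall>x\<in>D. \<kappa> (angle_cover (g x)) = to_blowup (g1 x)"
    by (rule blowup_chart_local_params[OF g(3,4,2)])
  then show ?thesis using that[of g1] by (simp add: g(1))
qed

text \<open>\<open>f\<close> is a map read in the source chart and \<open>q\<close> the target
  boundary chart. Hypothesis \<open>eq\<close> says that, seen in the ball complement, the map is
  the identity, so its local expression is a boundary transition map. This form serves both the
  sphere map and its inverse.\<close>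

lemma boundary_chart_maps_smooth:
  fixes g g' :: "real^4 \<Rightarrow> 'e::euclidean_space"
  assumes g: "(D, g) \<in> local_params {z. 1 \<le> norm z}" and g': "(D', g') \<in> local_params {z. 1 \<le> norm z}"
    and inj: "inj_on q (bdry -` D')"
    and eq: "\<And>y y'. bdry y \<in> D \<Longrightarrow> bdry y' \<in> D' \<Longrightarrow> f y = q y' \<longleftrightarrow> g (bdry y) = g' (bdry y')"
  shows "open {y \<in> bdry -` D. f y \<in> q ` (bdry -` D')}" (is "open ?S")
    and "smooth_on {y \<in> bdry -` D. f y \<in> q ` (bdry -` D')} (\<lambda>y. the_inv_into (bdry -` D') q (f y))"
proof -
  have loc: "\<exists>W K. open W \<and> y0 \<in> W \<and> W \<subseteq> ?S \<and> (\<forall>k. Ck_on k W K) \<and>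
    (\<forall>y\<in>W. the_inv_into (bdry -` D') q (f y) = K y)" if "y0 \<in> ?S" for y0
  proof -
    have "bdry y0 \<in> D" "g (bdry y0) \<in> g' ` D'" using that eq by auto
    from boundary_transition[OF g g' this] obtain W K where W: "open W" "y0 \<in> W" "\<And>k. Ck_on k W K"
      "\<And>y. y \<in> W \<Longrightarrow> bdry y \<in> D \<and> bdry (K y) \<in> D' \<and> g' (bdry (K y)) = g (bdry y)" by metis
    have "f y = q (K y)" if "y \<in> W" for y using W(4)[OF that] eq[of y "K y"] by simp
    then show ?thesis
      using W inj by (intro exI[of _ W] exI[of _ K]) (auto simp: the_inv_into_f_f)
  qed
  show "open ?S"
  proof (subst open_subopen, intro ballI)
    fix y0 assume "y0 \<in> ?S"
    from loc[OF this] show "\<exists>T. open T \<and> y0 \<in> T \<and> T \<subseteq> ?S" by (elim exE conjE) (intro exI conjI)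
  qed
  show "smooth_on ?S (\<lambda>y. the_inv_into (bdry -` D') q (f y))"
  proof (rule smooth_onI)
    fix y0 assume "y0 \<in> ?S"
    from loc[OF this] obtain W K where "open W" "y0 \<in> W" "\<forall>k. Ck_on k W K"
      "\<forall>y\<in>W. the_inv_into (bdry -` D') q (f y) = K y"
      by (elim exE conjE) (rule that)
    then show "\<exists>U F. open U \<and> y0 \<in> U \<and> (\<forall>k. Ck_on k U F) \<and>
        (\<forall>y\<in>?S \<inter> U. F y = the_inv_into (bdry -` D') q (f y))"
      by (intro exI[of _ W] exI[of _ K]) simp
  qed
qed

section \<open>The diffeomorphism\<close>

lemma ball_complement_atlas_eq: "ball_complement_atlas = local_params {z. 1 \<le> norm z}"
proof -
  have "{(z1, z2). 1 \<le> (norm z1)\<^sup>2 + (norm z2)\<^sup>2} = {z :: complex \<times> complex. 1 \<le> norm z}"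
    by (auto simp: norm_Pair)
  then show ?thesis by (simp add: ball_complement_atlas_def)
qed

lemma inj_on_bdry_chart:
  assumes "inj_on g D"
  shows "inj_on (g \<circ> bdry) (bdry -` D)"
proof (rule inj_onI)
  fix y y' assume "y \<in> bdry -` D" "y' \<in> bdry -` D" "(g \<circ> bdry) y = (g \<circ> bdry) y'"
  then have "bdry y = bdry y'" using assms by (auto dest: inj_onD)
  then show "y = y'" by (metis tail3_bdry)
qed

lemma inj_on_to_blowup_chart:
  assumes "(D, g) \<in> local_params {z. 1 \<le> norm z}" "\<forall>x\<in>D. p x = to_blowup (g x)"
  shows "inj_on p D"
proof (rule inj_onI)
  note P = local_paramsD[OF assms(1)]
  fix x x' assume x: "x \<in> D" "x' \<in> D" "p x = p x'"
  then have "1 \<le> norm (g x)" "1 \<le> norm (g x')" using P(7) by auto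
  then have "g x = g x'" using to_blowup_inject assms(2) x by simp
  then show "x = x'" using P(3) x by (auto dest: inj_onD)
qed

lemma bij_betw_S3_to_linf: "bij_betw (At_infinity \<circ> S3_to_linf) S3 (range At_infinity)"
proof (rule bij_betw_imageI)
  show "inj_on (At_infinity \<circ> S3_to_linf) S3"
    by (rule inj_onI) (simp add: S3_eq S3_to_linf_inject)
  show "(At_infinity \<circ> S3_to_linf) ` S3 = range At_infinity"
  proof (intro equalityI subsetI)
    fix b assume "b \<in> range At_infinity"
    then obtain x where "b = At_infinity x" by blast
    moreover obtain z where "norm z = 1" "S3_to_linf z = x" using S3_to_linf_surj by blast
    ultimately show "b \<in> (At_infinity \<circ> S3_to_linf) ` S3"
      by (intro image_eqI[of _ _ z]) (simp_all add: S3_eq)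
  qed auto
qed

lemma bdry_charts_eq_iff:
  assumes g: "(D, g) \<in> local_params {z. 1 \<le> norm z}" and g': "(D', g') \<in> local_params {z. 1 \<le> norm z}"
    and p: "\<forall>x\<in>D'. p x = to_blowup (g' x)" and y: "bdry y \<in> D" "bdry y' \<in> D'"
  shows "(At_infinity \<circ> S3_to_linf) (g (bdry y)) = p (bdry y') \<longleftrightarrow> g (bdry y) = g' (bdry y')"
proof -
  have n: "norm (g (bdry y)) = 1" "norm (g' (bdry y')) = 1"
    using local_params_ball_complement_norm[OF g y(1)] local_params_ball_complement_norm[OF g' y(2)] by simp_all
  have "p (bdry y') = At_infinity (S3_to_linf (g' (bdry y')))"
    using p y(2) to_blowup_S3[OF n(2)] by simp
  then show ?thesis using S3_to_linf_inject[OF n] by auto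
qed

lemma smooth_map_S3_to_linf:
  "smooth_map (boundary_atlas ball_complement_atlas) (boundary_atlas blowup_atlas) (At_infinity \<circ> S3_to_linf)"
  unfolding smooth_map_def boundary_atlas_eq ball_complement_atlas_eq
proof (intro ballI, clarify)
  fix D D' and g :: "real^4 \<Rightarrow> complex \<times> complex" and p :: "real^4 \<Rightarrow> blowup"
  assume g: "(D, g) \<in> local_params {z. 1 \<le> norm z}" and p: "(D', p) \<in> blowup_atlas"
  let ?f = "\<lambda>y. (At_infinity \<circ> S3_to_linf) ((g \<circ> bdry) y)"
  let ?S = "{y \<in> bdry -` D. ?f y \<in> (p \<circ> bdry) ` (bdry -` D')}"
  show "open ?S \<and> smooth_on ?S (\<lambda>y. the_inv_into (bdry -` D') (p \<circ> bdry) (?f y))"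
  \<comment> \<open>Charts that miss the boundary contribute a boundary chart with empty domain;
    only the others correspond to charts of the ball complement.\<close>
  proof (cases "bdry -` D' = {}")
    case True
    then show ?thesis by (simp add: smooth_on_def)
  next
    case False
    obtain g' where g': "(D', g') \<in> local_params {z. 1 \<le> norm z}" "\<forall>x\<in>D'. p x = to_blowup (g' x)"
      by (rule blowup_atlas_cases[OF p False])
    have "?f y = (p \<circ> bdry) y' \<longleftrightarrow> g (bdry y) = g' (bdry y')" if "bdry y \<in> D" "bdry y' \<in> D'" for y y'
      using bdry_charts_eq_iff[OF g g' that] by simp
    then show ?thesis
      using boundary_chart_maps_smooth[OF g g'(1) inj_on_bdry_chart[OF inj_on_to_blowup_chart[OF g']], of ?f]
      by blast
  qed
qed

lemma smooth_map_S3_to_linf_inv: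
  "smooth_map (boundary_atlas blowup_atlas) (boundary_atlas ball_complement_atlas)
    (inv_into S3 (At_infinity \<circ> S3_to_linf))"
  unfolding smooth_map_def boundary_atlas_eq ball_complement_atlas_eq
proof (intro ballI, clarify)
  fix D D' and p :: "real^4 \<Rightarrow> blowup" and g' :: "real^4 \<Rightarrow> complex \<times> complex"
  assume p: "(D, p) \<in> blowup_atlas" and g': "(D', g') \<in> local_params {z. 1 \<le> norm z}"
  let ?f = "\<lambda>y. inv_into S3 (At_infinity \<circ> S3_to_linf) ((p \<circ> bdry) y)"
  let ?S = "{y \<in> bdry -` D. ?f y \<in> (g' \<circ> bdry) ` (bdry -` D')}"
  show "open ?S \<and> smooth_on ?S (\<lambda>y. the_inv_into (bdry -` D') (g' \<circ> bdry) (?f y))"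
  proof (cases "bdry -` D = {}")
    case True
    then show ?thesis by (simp add: smooth_on_def)
  next
    case False
    obtain g where g: "(D, g) \<in> local_params {z. 1 \<le> norm z}" "\<forall>x\<in>D. p x = to_blowup (g x)"
      by (rule blowup_atlas_cases[OF p False])
    have "?f y = (g' \<circ> bdry) y' \<longleftrightarrow> g (bdry y) = g' (bdry y')" if y: "bdry y \<in> D" for y y'
    proof -
      have n: "norm (g (bdry y)) = 1"
        using local_params_ball_complement_norm[OF g(1) y] by simp
      have "(p \<circ> bdry) y = (At_infinity \<circ> S3_to_linf) (g (bdry y))"
        using g(2) y to_blowup_S3[OF n] by simp
      moreover have "g (bdry y) \<in> S3" using n by (simp add: S3_eq)
      ultimately have "?f y = g (bdry y)"
        using inv_into_f_f[OF bij_betw_imp_inj_on[OF bij_betw_S3_to_linf]] by simp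
      then show ?thesis by simp
    qed
    then show ?thesis
      using boundary_chart_maps_smooth[OF g(1) g' inj_on_bdry_chart[OF local_paramsD(3)[OF g']], of ?f]
      by blast
  qed
qed

text \<open>At interior parameters the affine coordinates of \<open>p\<close> are the radial
  inversion of \<open>g\<close>. Their Jacobian determinant is positive by hypothesis and that of
  the inversion is negative, which leaves a negative sign for \<open>g\<close>.\<close>

lemma to_blowup_reverses_orientation:
  assumes p: "(D, p) \<in> complex_positive affine_coords blowup_atlas"
    and g: "(D, g) \<in> local_params {z. 1 \<le> norm z}" "\<forall>x\<in>D. p x = to_blowup (g x)"
    and x: "x \<in> D" "x $ 1 < 0"
  shows "det (matrix (frechet_derivative (\<lambda>x. real_coords (g x)) (at x))) < 0"
proof -
  note P = local_paramsD[OF g(1)]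
  have norm_gt: "1 < norm (g x)" if "x \<in> D" "x $ 1 < 0" for x
  proof -
    have "1 \<le> norm (g x)" using P(7) that(1) by blast
    moreover have "norm (g x) \<noteq> 1"
      using local_params_ball_complement_norm[OF g(1) that(1)] that(2) by simp
    ultimately show ?thesis by simp
  qed
  let ?G = "frechet_derivative (\<lambda>x. real_coords (g x)) (at x)"
  let ?I = "frechet_derivative radial_inversion (at (real_coords (g x)))"
  have "g differentiable (at x)" by (rule local_params_differentiable_interior[OF g(1) x])
  then have "(\<lambda>x. real_coords (g x)) differentiable (at x)"
    using bounded_linear.has_derivative[OF bounded_linear_real_coords]
    unfolding differentiable_def by blast
  then have G: "((\<lambda>x. real_coords (g x)) has_derivative ?G) (at x)"
    by (simp add: frechet_derivative_works)
  have n: "1 < norm (real_coords (g x))" using norm_gt[OF x] by simp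
  note I = radial_inversion_derivative_det_neg[OF n]
  have I': "(radial_inversion has_derivative ?I) (at (real_coords (g x)))"
    using I(1) by (simp add: frechet_derivative_works)
  obtain U where U: "open U" "D = half_space4 \<inter> U" using P(1) by (auto simp: openin_open)
  have "((\<lambda>x. real_coords (affine_coords (p x))) has_derivative (\<lambda>v. ?I (?G v))) (at x)"
  proof (rule has_derivative_transform_within_open[OF has_derivative_compose[OF G I']])
    show "open (U \<inter> {x. x $ 1 < 0})" using U(1) open_interior_half_space4 by blast
    show "x \<in> U \<inter> {x. x $ 1 < 0}" using x U(2) by blast
    fix x' assume "x' \<in> U \<inter> {x. x $ 1 < 0}"
    then have x': "x' \<in> D" "x' $ 1 < 0" using U(2) interior_half_space4_mem by auto
    then show "radial_inversion (real_coords (g x')) = real_coords (affine_coords (p x'))"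
      using norm_gt[OF x'] g(2) by (simp add: to_blowup_def real_coords_radial_inversion)
  qed
  then have "frechet_derivative (\<lambda>x. real_coords (affine_coords (p x))) (at x) = (\<lambda>v. ?I (?G v))"
    by (rule frechet_derivative_at[symmetric])
  moreover have "0 < det (matrix (frechet_derivative (\<lambda>x. real_coords (affine_coords (p x))) (at x)))"
    using p x by (simp add: complex_positive_def)
  ultimately have "0 < det (matrix ?I) * det (matrix ?G)"
    by (simp only: det_matrix_compose[OF has_derivative_bounded_linear[OF G] has_derivative_bounded_linear[OF I']])
  then show ?thesis using I(2) by (simp add: zero_less_mult_iff)
qed

definition flip1 :: "real^3 \<Rightarrow> real^3" where
  "flip1 y = vector [- y $ 1, y $ 2, y $ 3]"

lemma flip1_nth [simp]: "flip1 y $ 1 = - y $ 1" "flip1 y $ 2 = y $ 2" "flip1 y $ 3 = y $ 3"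
  by (simp_all add: flip1_def)

lemma flip1_flip1 [simp]: "flip1 (flip1 y) = y"
  by (simp add: vec_eq_iff forall_3)

lemma bounded_linear_flip1: "bounded_linear flip1"
  by (intro linear_conv_bounded_linear[THEN iffD1] linearI) (simp_all add: vec_eq_iff forall_3)

lemma det_flip1: "det (matrix flip1) = -1"
  by (simp add: det_3 matrix_def axis_def)

lemma opposite_atlas_eq:
  "opposite_atlas A = (\<lambda>(E, q). (flip1 -` E, q \<circ> flip1)) ` A"
  by (simp add: opposite_atlas_def vimage_def comp_def flip1_def[abs_def])

lemma orientation_preserving_S3_to_linf:
  "orientation_preserving (boundary_atlas (complex_positive id ball_complement_atlas))
    linf_standard_atlas (At_infinity \<circ> S3_to_linf)"
  unfolding orientation_preserving_def linf_standard_atlas_def opposite_atlas_eq boundary_atlas_eq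
    image_image ball_complement_atlas_eq
proof (intro ballI, clarify)
  fix D D' and g :: "real^4 \<Rightarrow> complex \<times> complex" and p :: "real^4 \<Rightarrow> blowup" and y0 y1
  let ?f = "\<lambda>y. (At_infinity \<circ> S3_to_linf) ((g \<circ> bdry) y)"
  let ?q = "p \<circ> bdry \<circ> flip1"
  let ?E = "flip1 -` (bdry -` D')"
  assume g_pos: "(D, g) \<in> complex_positive id (local_params {z. 1 \<le> norm z})"
    and p: "(D', p) \<in> complex_positive affine_coords blowup_atlas"
    and y0: "bdry y0 \<in> D" and y1: "bdry (flip1 y1) \<in> D'" and eq: "?f y0 = ?q y1"
  have g: "(D, g) \<in> local_params {z. 1 \<le> norm z}" and p': "(D', p) \<in> blowup_atlas"
    using g_pos p by (simp_all add: complex_positive_def)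
  have "bdry -` D' \<noteq> {}" using y1 by blast
  then obtain g' where g': "(D', g') \<in> local_params {z. 1 \<le> norm z}" "\<forall>x\<in>D'. p x = to_blowup (g' x)"
    by (rule blowup_atlas_cases[OF p'])
  note iff = bdry_charts_eq_iff[OF g g']
  have "g (bdry y0) \<in> g' ` D'" using iff[OF y0 y1] eq y1 by auto
  then obtain W K where W: "open W" "y0 \<in> W" "\<And>k. Ck_on k W K"
    "\<And>y. y \<in> W \<Longrightarrow> bdry y \<in> D \<and> bdry (K y) \<in> D' \<and> g' (bdry (K y)) = g (bdry y)"
    "det (matrix (frechet_derivative K (at y0))) < 0"
  proof (rule boundary_transition_orientation[OF g g'(1) y0])
    show "0 < det (matrix (frechet_derivative (\<lambda>x. real_coords (g x)) (at x)))"
      if "x \<in> D" "x $ 1 < 0" for x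
      using g_pos that by (simp add: complex_positive_def)
  qed (use to_blowup_reverses_orientation[OF p g'] in auto)
  have inj: "inj_on ?q ?E"
  proof (rule inj_onI)
    fix y y' assume "y \<in> ?E" "y' \<in> ?E" "?q y = ?q y'"
    then have "flip1 y = flip1 y'"
      by (intro inj_onD[OF inj_on_bdry_chart[OF inj_on_to_blowup_chart[OF g']]]) simp_all
    then show "y = y'" by (metis flip1_flip1)
  qed
  \<comment> \<open>In the opposite atlas the map is expressed by \<open>flip1\<close> after
    \<open>K\<close>. Both have negative determinant, so their composite preserves
    orientation.\<close>
  have inv: "flip1 (K y) = the_inv_into ?E ?q (?f y)" if y: "y \<in> W" for y
  proof -
    have "?q (flip1 (K y)) = ?f y" "flip1 (K y) \<in> ?E"
      using W(4)[OF y] iff[of y "K y"] by simp_all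
    then show ?thesis using the_inv_into_f_f[OF inj] by metis
  qed
  have K: "(K has_derivative frechet_derivative K (at y0)) (at y0)"
    by (rule Ck_on_SucD[OF W(3,2)])
  have "((\<lambda>y. the_inv_into ?E ?q (?f y)) has_derivative (\<lambda>v. flip1 (frechet_derivative K (at y0) v))) (at y0)"
    by (rule has_derivative_transform_within_open[OF bounded_linear.has_derivative[OF bounded_linear_flip1 K] W(1,2) inv])
  then have "frechet_derivative (\<lambda>y. the_inv_into ?E ?q (?f y)) (at y0) =
      (\<lambda>v. flip1 (frechet_derivative K (at y0) v))"
    by (rule frechet_derivative_at[symmetric])
  then show "0 < det (matrix (frechet_derivative (\<lambda>y. the_inv_into ?E ?q (?f y)) (at y0)))"
    using W(5) by (simp only: det_matrix_compose[OF has_derivative_bounded_linear[OF K] bounded_linear_flip1] det_flip1)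
qed

theorem mainTheorem5:
  "((\<forall>(z1, z2)\<in>S3.
       (z1 \<noteq> 0 \<longrightarrow> S3_to_linf (z1, z2) = linf_chart1 (z2 / z1, - arg z1)) \<and>
       (z2 \<noteq> 0 \<longrightarrow> S3_to_linf (z1, z2) = linf_chart2 (z1 / z2, - arg z2))) \<and>
    diffeomorphism S3 (boundary_atlas ball_complement_atlas)
      (range At_infinity) (boundary_atlas blowup_atlas) (At_infinity \<circ> S3_to_linf) \<and>
    orientation_preserving
      (boundary_atlas (complex_positive id ball_complement_atlas)) linf_standard_atlas
      (At_infinity \<circ> S3_to_linf)) \<and>
   (\<forall>\<Theta>. \<forall>z\<in>S3. S3_to_linf (S3_action \<Theta> z) = linf_action \<Theta> (S3_to_linf z))"
proof (intro conjI)
  show "\<forall>(z1, z2)\<in>S3.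
       (z1 \<noteq> 0 \<longrightarrow> S3_to_linf (z1, z2) = linf_chart1 (z2 / z1, - arg z1)) \<and>
       (z2 \<noteq> 0 \<longrightarrow> S3_to_linf (z1, z2) = linf_chart2 (z1 / z2, - arg z2))"
    using S3_to_linf_chart1 S3_to_linf_chart2 by blast
  show "diffeomorphism S3 (boundary_atlas ball_complement_atlas)
      (range At_infinity) (boundary_atlas blowup_atlas) (At_infinity \<circ> S3_to_linf)"
    unfolding diffeomorphism_def
    by (intro conjI bij_betw_S3_to_linf smooth_map_S3_to_linf smooth_map_S3_to_linf_inv)
qed (use orientation_preserving_S3_to_linf S3_to_linf_action in auto)

end
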